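(* Let $(\mu_n)_{n\ge1}$ be a sequence of positive real numbers with $\mu_n\to\infty$, and for $(\alpha,\beta,\gamma)\in E$ let $\lambda_{n,1},\dots,\lambda_{n,4}$ be the four complex roots (with multiplicity) of $$\lambda^4+\mu_n^\beta\lambda^3+(\mu_n+\mu_n^{2\alpha}+2\mu_n^\gamma)\lambda^2+2\mu_n^{\beta+\gamma}\lambda+2\mu_n^{1+\gamma}=0 .$$ Then for each fixed $(\alpha,\beta,\gamma)$ in one of the regions below (defined in the context), the roots, suitably numbered, satisfy as $n\to\infty$ (we write $\mu=\mu_n$; every expression $X$ below stands for $X\cdot(1+o(1))$, separately for the real part and for the imaginary part, except that $(c\pm id)\mu^s$ stands for $(c\pm id)\mu^s(1+o(1))$; first item: $\lambda_{n,1},\lambda_{n,2}$; second item: $\lambda_{n,3},\lambda_{n,4}$): $V_1$: $-\frac14\mu^{2\alpha+\beta-\gamma}\pm i\sqrt2\,\mu^{\gamma/2}$; $\ -\frac12\mu^\beta\pm i\mu^{1/2}$. $V_2$: $-\frac12\mu^\beta\pm i\mu^\alpha$; $\ -\mu^{-2\alpha+\beta+\gamma}\pm i\sqrt2\,\mu^{-\alpha+\frac\gamma2+\frac12}$. $V_3$: $-\frac14\mu^{2\alpha+\beta-\gamma}\pm i\sqrt2\,\mu^{\gamma/2}$; $\ -\mu^{1-\beta}$ and $-\mu^\beta$. $V_4$: $-\frac12\mu^\beta\pm i\mu^\alpha$; $\ -\mu^{1-\beta}$ and $-2\mu^{-2\alpha+\beta+\gamma}$. $V_5$: $-\mu^{1-\beta}$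 and $-\mu^\beta$; $\ -\frac12\mu^{2\alpha-\beta}\pm i\sqrt2\,\mu^{\gamma/2}$. $V_6$: $-\mu^{2\alpha-\beta}$ and $-\mu^\beta$; $\ -2\mu^{-2\alpha+\beta+\gamma}$ and $-\mu^{1-\beta}$. $F_{12}$: $-\frac16\mu^\beta\pm i\sqrt3\,\mu^{\gamma/2}$; $\ -\frac13\mu^\beta\pm i\frac{\sqrt6}3\mu^{1/2}$. $F_{13}$: $-\frac14\mu^{2\alpha+\beta-\gamma}\pm i\sqrt2\,\mu^{\gamma/2}$; $\ -\frac12\mu^\beta\pm i\frac{\sqrt3}2\mu^{1/2}$. $F_{24}$: $-\frac12\mu^\beta\pm i\mu^\alpha$; $\ (-1\pm i)\mu^{1-\beta}$. $F_{34}$: $-\frac16\mu^\beta\pm i\sqrt3\,\mu^{\gamma/2}$; $\ -\mu^{1-\beta}$ and $-\frac23\mu^\beta$. $F_{35}$: $-\mu^{1-\beta}$ and $-\mu^\beta$; $\ -\frac16\mu^{2\alpha-\beta}\pm i\sqrt2\,\mu^{\gamma/2}$. $L_{1234}$: $-\frac16\mu^{1/2}\pm i\sqrt3\,\mu^{\gamma/2}$; $\ (-\frac13\pm i\frac{\sqrt5}3)\mu^{1/2}$. $F_1$: $-\mu^{2\alpha+\beta-1}\pm i\sqrt2\,\mu^{1/2}$; $\ -\frac12\mu^\beta\pm i\mu^{1/2}$. $L_{12}$: $-\frac14\mu^\beta\pm i\sqrt{2+\sqrt2}\,\mu^{1/2}$; $\ -\frac14\mu^\beta\pm i\sqrt{2-\sqrt2}\,\mu^{1/2}$.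 $L_{15}$: $-\frac13\mu^{2\alpha-\frac12}\pm i\sqrt2\,\mu^{1/2}$; $\ -\frac12\mu^{1/2}\pm i\frac{\sqrt3}2\mu^{1/2}$. $L_{26}$: $-\frac12\mu^\beta\pm i\frac{\sqrt3}2\mu^\alpha$; $\ (-1\pm i)\mu^{1-\beta}$. $\bar V_1$: $-\frac12\mu^\beta\pm i\mu^{1/2}$; $\ -\mu^{2\alpha+\beta+\gamma-2}\pm i\sqrt2\,\mu^{\gamma/2}$. $\bar V_2$: $-\frac12\mu^\beta\pm i\mu^\alpha$; $\ -\mu^{-2\alpha+\beta+\gamma}\pm i\sqrt2\,\mu^{-\alpha+\frac\gamma2+\frac12}$. $\bar V_3$: $-\mu^{1-\beta}$ and $-\mu^\beta$; $\ -\mu^{2\alpha+\beta+\gamma-2}\pm i\sqrt2\,\mu^{\gamma/2}$. $\bar V_4$: $-\mu^{2\alpha-\beta}$ and $-\mu^\beta$; $\ -\mu^{-2\alpha+\beta+\gamma}\pm i\sqrt2\,\mu^{-\alpha+\frac\gamma2+\frac12}$. $\bar V_5$: $-\mu^{1-\beta}$ and $-\mu^\beta$; $\ -\frac12\mu^{2\alpha-\beta}\pm i\sqrt2\,\mu^{\gamma/2}$. $\bar F_{12}$: $-\frac12\mu^\beta\pm i\sqrt2\,\mu^{1/2}$; $\ -\frac14\mu^{\beta+\gamma-1}\pm i\mu^{\gamma/2}$. $\bar F_{13}$: $-\frac12\mu^{1/2}\pm i\frac{\sqrt3}2\mu^{1/2}$; $\ -\mu^{2\alpha+\gamma-\frac32}\pm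 i\sqrt2\,\mu^{\gamma/2}$. $\bar F_{24}$: $-\frac12\mu^\alpha\pm i\frac{\sqrt3}2\mu^\alpha$; $\ -\mu^{\gamma-\alpha}\pm i\sqrt2\,\mu^{-\alpha+\frac\gamma2+\frac12}$. $\bar F_{34}$: $-2\mu^{1-\beta}$ and $-\mu^\beta$; $\ -\frac14\mu^{\beta+\gamma-1}\pm i\mu^{\gamma/2}$. $\bar F_{35}$: $-\mu^{\gamma/2}$ and $-\mu^{1-\frac\gamma2}$; $\ -\frac13\mu^{2\alpha+\frac\gamma2-1}\pm i\sqrt2\,\mu^{\gamma/2}$. $\bar L_{1234}$: $-\frac12\mu^{1/2}\pm i\frac{\sqrt7}2\mu^{1/2}$; $\ -\frac14\mu^{\gamma-\frac12}\pm i\mu^{\gamma/2}$.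
   Context: $E=\{(\alpha,\beta,\gamma): 0\le\alpha\le\frac{\gamma+1}2,\ 0\le\beta\le1,\ \frac12\le\gamma\le2\}$. All regions are subsets of $E$ given by the following conditions. Regions with $\gamma\ge1$: $V_1$: $0\le\alpha<\frac\gamma2$, $0\le\beta<\frac12$, $1<\gamma\le2$. $V_2$: $\frac\gamma2<\alpha\le\frac{\gamma+1}2$, $2\alpha-2\beta-\gamma+1>0$, $0\le\beta$, $1\le\gamma\le2$. $V_3$: $0\le\alpha<\frac\gamma2$, $\frac12<\beta<\frac\gamma2$, $1<\gamma\le2$. $V_4$: $\frac\gamma2<\alpha<\frac{\gamma+1}2$, $\beta\le1$, $\beta<\alpha$, $2\alpha-2\beta-\gamma+1<0$, $1<\gamma\le2$. $V_5$: $0\le\alpha$, $\frac\gamma2<\beta\le1$, $4\alpha-2\beta-\gamma<0$, $1\le\gamma<2$. $V_6$: $4\alpha-2\beta-\gamma>0$, $\alpha<\beta\le1$, $1\le\gamma<2$. $F_{12}$: $\alpha=\frac\gamma2$, $0\le\beta<\frac12$, $1<\gamma\le2$. $F_{13}$: $0\le\alpha<\frac\gamma2$, $\beta=\frac12$, $1<\gamma\le2$. $F_{24}$: $\frac\gamma2<\alpha\le\frac{1+\gamma}2$, $2\alpha-2\beta-\gamma+1=0$, $1<\gamma\le2$. $F_{34}$: $\alpha=\frac\gamma2$, $\frac12<\beta<\frac\gamma2$, $1<\gamma\le2$. $F_{35}$: $0\le\alpha<\frac\gamma2$, $\beta=\frac\gamma2$, $1<\gamma\le2$. $L_{1234}$: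 $\alpha=\frac\gamma2$, $\beta=\frac12$, $1<\gamma\le2$. $F_1$: $0\le\alpha<\frac12$, $0\le\beta<\frac12$, $\gamma=1$. $L_{12}$: $\alpha=\frac12$, $0\le\beta<\frac12$, $\gamma=1$. $L_{15}$: $0\le\alpha<\frac12$, $\beta=\frac12$, $\gamma=1$. $L_{26}$: $\frac12<\alpha\le1$, $\beta=\alpha$, $\gamma=1$. Regions with $\frac12\le\gamma<1$ (this condition is part of each definition): $\bar V_1$: $0\le\alpha<\frac12$, $0\le\beta<\frac12$. $\bar V_2$: $\frac12<\alpha\le\frac{\gamma+1}2$, $0\le\beta<\alpha$. $\bar V_3$: $0\le\alpha<\frac12$, $\frac12<\beta<1-\frac\gamma2$. $\bar V_4$: $\frac12<\alpha\le\frac{\gamma+1}2$, $\beta>\alpha$, $2\alpha-2\beta-\gamma+1>0$. $\bar V_5$: $0\le\alpha$, $1-\frac\gamma2<\beta\le1$, $4\alpha-2\beta-\gamma<0$. $\bar F_{12}$: $\alpha=\frac12$, $0\le\beta<\frac12$. $\bar F_{13}$: $0\le\alpha<\frac12$, $\beta=\frac12$. $\bar F_{24}$: $\frac12<\alpha\le\frac{1+\gamma}2$, $\beta=\alpha$. $\bar F_{34}$: $\alpha=\frac12$, $\frac12<\beta<1-\frac\gamma2$. $\bar F_{35}$: $0\le\alpha<\frac12$, $\beta=1-\frac\gamma2$. $\bar L_{1234}$: $\alpha=\frac12$, $\beta=\frac12$. *)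

theory Defs
  imports
    "HOL-Library.Landau_Symbols"
    "HOL-Computational_Algebra.Polynomial"
    "HOL-Combinatorics.Permutations"
begin

definition quartic :: "real \<Rightarrow> real \<Rightarrow> real \<Rightarrow> real \<Rightarrow> complex poly" where
  "quartic m \<alpha> \<beta> \<gamma> =
     [: of_real (2 * m powr (1 + \<gamma>)),
        of_real (2 * m powr (\<beta> + \<gamma>)),
        of_real (m + m powr (2 * \<alpha>) + 2 * m powr \<gamma>),
        of_real (m powr \<beta>),
        1 :]"

definition E :: "(real \<times> real \<times> real) set" where
  "E = {(\<alpha>, \<beta>, \<gamma>). 0 \<le> \<alpha> \<and> \<alpha> \<le> (\<gamma> + 1)/2 \<and> 0 \<le> \<beta> \<and> \<beta> \<le> 1 \<and> 1/2 \<le> \<gamma> \<and> \<gamma> \<le> 2}"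

definition V1 :: "(real \<times> real \<times> real) set" where
  "V1 = {(\<alpha>, \<beta>, \<gamma>) \<in> E. 0 \<le> \<alpha> \<and> \<alpha> < \<gamma>/2 \<and> 0 \<le> \<beta> \<and> \<beta> < 1/2 \<and> 1 < \<gamma> \<and> \<gamma> \<le> 2}"

definition V2 :: "(real \<times> real \<times> real) set" where
  "V2 = {(\<alpha>, \<beta>, \<gamma>) \<in> E. \<gamma>/2 < \<alpha> \<and> \<alpha> \<le> (\<gamma> + 1)/2 \<and> 2*\<alpha> - 2*\<beta> - \<gamma> + 1 > 0 \<and> 0 \<le> \<beta> \<and> 1 \<le> \<gamma> \<and> \<gamma> \<le> 2}"

definition V3 :: "(real \<times> real \<times> real) set" where
  "V3 = {(\<alpha>, \<beta>, \<gamma>) \<in> E. 0 \<le> \<alpha> \<and> \<alpha> < \<gamma>/2 \<and> 1/2 < \<beta> \<and> \<beta> < \<gamma>/2 \<and> 1 < \<gamma> \<and> \<gamma> \<le> 2}"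

definition V4 :: "(real \<times> real \<times> real) set" where
  "V4 = {(\<alpha>, \<beta>, \<gamma>) \<in> E. \<gamma>/2 < \<alpha> \<and> \<alpha> < (\<gamma> + 1)/2 \<and> \<beta> \<le> 1 \<and> \<beta> < \<alpha> \<and> 2*\<alpha> - 2*\<beta> - \<gamma> + 1 < 0 \<and> 1 < \<gamma> \<and> \<gamma> \<le> 2}"

definition V5 :: "(real \<times> real \<times> real) set" where
  "V5 = {(\<alpha>, \<beta>, \<gamma>) \<in> E. 0 \<le> \<alpha> \<and> \<gamma>/2 < \<beta> \<and> \<beta> \<le> 1 \<and> 4*\<alpha> - 2*\<beta> - \<gamma> < 0 \<and> 1 \<le> \<gamma> \<and> \<gamma> < 2}"

definition V6 :: "(real \<times> real \<times> real) set" where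
  "V6 = {(\<alpha>, \<beta>, \<gamma>) \<in> E. 4*\<alpha> - 2*\<beta> - \<gamma> > 0 \<and> \<alpha> < \<beta> \<and> \<beta> \<le> 1 \<and> 1 \<le> \<gamma> \<and> \<gamma> < 2}"

definition F12 :: "(real \<times> real \<times> real) set" where
  "F12 = {(\<alpha>, \<beta>, \<gamma>) \<in> E. \<alpha> = \<gamma>/2 \<and> 0 \<le> \<beta> \<and> \<beta> < 1/2 \<and> 1 < \<gamma> \<and> \<gamma> \<le> 2}"

definition F13 :: "(real \<times> real \<times> real) set" where
  "F13 = {(\<alpha>, \<beta>, \<gamma>) \<in> E. 0 \<le> \<alpha> \<and> \<alpha> < \<gamma>/2 \<and> \<beta> = 1/2 \<and> 1 < \<gamma> \<and> \<gamma> \<le> 2}"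

definition F24 :: "(real \<times> real \<times> real) set" where
  "F24 = {(\<alpha>, \<beta>, \<gamma>) \<in> E. \<gamma>/2 < \<alpha> \<and> \<alpha> \<le> (1 + \<gamma>)/2 \<and> 2*\<alpha> - 2*\<beta> - \<gamma> + 1 = 0 \<and> 1 < \<gamma> \<and> \<gamma> \<le> 2}"

definition F34 :: "(real \<times> real \<times> real) set" where
  "F34 = {(\<alpha>, \<beta>, \<gamma>) \<in> E. \<alpha> = \<gamma>/2 \<and> 1/2 < \<beta> \<and> \<beta> < \<gamma>/2 \<and> 1 < \<gamma> \<and> \<gamma> \<le> 2}"

definition F35 :: "(real \<times> real \<times> real) set" where
  "F35 = {(\<alpha>, \<beta>, \<gamma>) \<in> E. 0 \<le> \<alpha> \<and> \<alpha> < \<gamma>/2 \<and> \<beta> = \<gamma>/2 \<and> 1 < \<gamma> \<and> \<gamma> \<le> 2}"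

definition L1234 :: "(real \<times> real \<times> real) set" where
  "L1234 = {(\<alpha>, \<beta>, \<gamma>) \<in> E. \<alpha> = \<gamma>/2 \<and> \<beta> = 1/2 \<and> 1 < \<gamma> \<and> \<gamma> \<le> 2}"

definition F1 :: "(real \<times> real \<times> real) set" where
  "F1 = {(\<alpha>, \<beta>, \<gamma>) \<in> E. 0 \<le> \<alpha> \<and> \<alpha> < 1/2 \<and> 0 \<le> \<beta> \<and> \<beta> < 1/2 \<and> \<gamma> = 1}"

definition L12 :: "(real \<times> real \<times> real) set" where
  "L12 = {(\<alpha>, \<beta>, \<gamma>) \<in> E. \<alpha> = 1/2 \<and> 0 \<le> \<beta> \<and> \<beta> < 1/2 \<and> \<gamma> = 1}"

definition L15 :: "(real \<times> real \<times> real) set" where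
  "L15 = {(\<alpha>, \<beta>, \<gamma>) \<in> E. 0 \<le> \<alpha> \<and> \<alpha> < 1/2 \<and> \<beta> = 1/2 \<and> \<gamma> = 1}"

definition L26 :: "(real \<times> real \<times> real) set" where
  "L26 = {(\<alpha>, \<beta>, \<gamma>) \<in> E. 1/2 < \<alpha> \<and> \<alpha> \<le> 1 \<and> \<beta> = \<alpha> \<and> \<gamma> = 1}"

definition V1_bar :: "(real \<times> real \<times> real) set" where
  "V1_bar = {(\<alpha>, \<beta>, \<gamma>) \<in> E. 1/2 \<le> \<gamma> \<and> \<gamma> < 1 \<and> 0 \<le> \<alpha> \<and> \<alpha> < 1/2 \<and> 0 \<le> \<beta> \<and> \<beta> < 1/2}"

definition V2_bar :: "(real \<times> real \<times> real) set" where
  "V2_bar = {(\<alpha>, \<beta>, \<gamma>) \<in> E. 1/2 \<le> \<gamma> \<and> \<gamma> < 1 \<and> 1/2 < \<alpha> \<and> \<alpha> \<le> (\<gamma> + 1)/2 \<and> 0 \<le> \<beta> \<and> \<beta> < \<alpha>}"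

definition V3_bar :: "(real \<times> real \<times> real) set" where
  "V3_bar = {(\<alpha>, \<beta>, \<gamma>) \<in> E. 1/2 \<le> \<gamma> \<and> \<gamma> < 1 \<and> 0 \<le> \<alpha> \<and> \<alpha> < 1/2 \<and> 1/2 < \<beta> \<and> \<beta> < 1 - \<gamma>/2}"

definition V4_bar :: "(real \<times> real \<times> real) set" where
  "V4_bar = {(\<alpha>, \<beta>, \<gamma>) \<in> E. 1/2 \<le> \<gamma> \<and> \<gamma> < 1 \<and> 1/2 < \<alpha> \<and> \<alpha> \<le> (\<gamma> + 1)/2 \<and> \<beta> > \<alpha> \<and> 2*\<alpha> - 2*\<beta> - \<gamma> + 1 > 0}"

definition V5_bar :: "(real \<times> real \<times> real) set" where
  "V5_bar = {(\<alpha>, \<beta>, \<gamma>) \<in> E. 1/2 \<le> \<gamma> \<and> \<gamma> < 1 \<and> 0 \<le> \<alpha> \<and> 1 - \<gamma>/2 < \<beta> \<and> \<beta> \<le> 1 \<and> 4*\<alpha> - 2*\<beta> - \<gamma> < 0}"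

definition F12_bar :: "(real \<times> real \<times> real) set" where
  "F12_bar = {(\<alpha>, \<beta>, \<gamma>) \<in> E. 1/2 \<le> \<gamma> \<and> \<gamma> < 1 \<and> \<alpha> = 1/2 \<and> 0 \<le> \<beta> \<and> \<beta> < 1/2}"

definition F13_bar :: "(real \<times> real \<times> real) set" where
  "F13_bar = {(\<alpha>, \<beta>, \<gamma>) \<in> E. 1/2 \<le> \<gamma> \<and> \<gamma> < 1 \<and> 0 \<le> \<alpha> \<and> \<alpha> < 1/2 \<and> \<beta> = 1/2}"

definition F24_bar :: "(real \<times> real \<times> real) set" where
  "F24_bar = {(\<alpha>, \<beta>, \<gamma>) \<in> E. 1/2 \<le> \<gamma> \<and> \<gamma> < 1 \<and> 1/2 < \<alpha> \<and> \<alpha> \<le> (1 + \<gamma>)/2 \<and> \<beta> = \<alpha>}"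

definition F34_bar :: "(real \<times> real \<times> real) set" where
  "F34_bar = {(\<alpha>, \<beta>, \<gamma>) \<in> E. 1/2 \<le> \<gamma> \<and> \<gamma> < 1 \<and> \<alpha> = 1/2 \<and> 1/2 < \<beta> \<and> \<beta> < 1 - \<gamma>/2}"

definition F35_bar :: "(real \<times> real \<times> real) set" where
  "F35_bar = {(\<alpha>, \<beta>, \<gamma>) \<in> E. 1/2 \<le> \<gamma> \<and> \<gamma> < 1 \<and> 0 \<le> \<alpha> \<and> \<alpha> < 1/2 \<and> \<beta> = 1 - \<gamma>/2}"

definition L1234_bar :: "(real \<times> real \<times> real) set" where
  "L1234_bar = {(\<alpha>, \<beta>, \<gamma>) \<in> E. 1/2 \<le> \<gamma> \<and> \<gamma> < 1 \<and> \<alpha> = 1/2 \<and> \<beta> = 1/2}"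

text \<open>
  Each of the following predicates states the asymptotic behaviour of a pair of root sequences
  \<open>z\<close>, \<open>w\<close>. For a real sequence \<open>X\<close>, \<open>f \<sim>[sequentially] X\<close> says \<open>f = X (1 + o(1))\<close>; for
  \<open>X = 0\<close> it says that \<open>f\<close> is eventually zero.
\<close>

text \<open>\<open>c \<mu>\<^sup>s \<plusminus> i d \<mu>\<^sup>t\<close>, with a factor \<open>1 + o(1)\<close> on the real and on the imaginary part separately.\<close>
definition sep_pair ::
  "real \<Rightarrow> real \<Rightarrow> real \<Rightarrow> real \<Rightarrow> (nat \<Rightarrow> real) \<Rightarrow> (nat \<Rightarrow> complex) \<Rightarrow> (nat \<Rightarrow> complex) \<Rightarrow> bool" where
  "sep_pair c s d t \<mu> z w \<longleftrightarrow>
     (\<lambda>n. Re (z n)) \<sim>[sequentially] (\<lambda>n. c * \<mu> n powr s) \<and>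
     (\<lambda>n. Im (z n)) \<sim>[sequentially] (\<lambda>n. d * \<mu> n powr t) \<and>
     (\<lambda>n. Re (w n)) \<sim>[sequentially] (\<lambda>n. c * \<mu> n powr s) \<and>
     (\<lambda>n. Im (w n)) \<sim>[sequentially] (\<lambda>n. - d * \<mu> n powr t)"

text \<open>\<open>c \<mu>\<^sup>s\<close> and \<open>d \<mu>\<^sup>t\<close>; the imaginary part is \<open>0 (1 + o(1))\<close>, so both roots are real eventually.\<close>
definition real_pair ::
  "real \<Rightarrow> real \<Rightarrow> real \<Rightarrow> real \<Rightarrow> (nat \<Rightarrow> real) \<Rightarrow> (nat \<Rightarrow> complex) \<Rightarrow> (nat \<Rightarrow> complex) \<Rightarrow> bool" where
  "real_pair c s d t \<mu> z w \<longleftrightarrow>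
     (\<lambda>n. Re (z n)) \<sim>[sequentially] (\<lambda>n. c * \<mu> n powr s) \<and>
     (\<lambda>n. Im (z n)) \<sim>[sequentially] (\<lambda>n. 0) \<and>
     (\<lambda>n. Re (w n)) \<sim>[sequentially] (\<lambda>n. d * \<mu> n powr t) \<and>
     (\<lambda>n. Im (w n)) \<sim>[sequentially] (\<lambda>n. 0)"

text \<open>\<open>(c \<plusminus> i d) \<mu>\<^sup>s\<close>, with a complex factor \<open>1 + o(1)\<close>.\<close>
definition cplx_pair ::
  "real \<Rightarrow> real \<Rightarrow> real \<Rightarrow> (nat \<Rightarrow> real) \<Rightarrow> (nat \<Rightarrow> complex) \<Rightarrow> (nat \<Rightarrow> complex) \<Rightarrow> bool" where
  "cplx_pair c d s \<mu> z w \<longleftrightarrow>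
     z \<sim>[sequentially] (\<lambda>n. Complex c d * of_real (\<mu> n powr s)) \<and>
     w \<sim>[sequentially] (\<lambda>n. Complex c (- d) * of_real (\<mu> n powr s))"

text \<open>
  After a renumbering of the four roots, which may depend on \<open>n\<close>, the first two satisfy \<open>A\<close> and the
  last two satisfy \<open>B\<close>. The value at \<open>n = 0\<close> plays no role.
\<close>
definition roots_asymp ::
  "(nat \<Rightarrow> real) \<Rightarrow> (nat \<Rightarrow> nat \<Rightarrow> complex) \<Rightarrow>
   ((nat \<Rightarrow> real) \<Rightarrow> (nat \<Rightarrow> complex) \<Rightarrow> (nat \<Rightarrow> complex) \<Rightarrow> bool) \<Rightarrow>
   ((nat \<Rightarrow> real) \<Rightarrow> (nat \<Rightarrow> complex) \<Rightarrow> (nat \<Rightarrow> complex) \<Rightarrow> bool) \<Rightarrow> bool" where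
  "roots_asymp \<mu> r A B \<longleftrightarrow>
     (\<exists>\<sigma>. (\<forall>n\<ge>1. \<sigma> n permutes {1..4}) \<and>
          A \<mu> (\<lambda>n. r n (\<sigma> n 1)) (\<lambda>n. r n (\<sigma> n 2)) \<and>
          B \<mu> (\<lambda>n. r n (\<sigma> n 3)) (\<lambda>n. r n (\<sigma> n 4)))"

end

theory Submission
  imports Defs "HOL-Computational_Algebra.Fundamental_Theorem_Algebra"
begin

text \<open>
  If the terms of the quartic at \<open>c \<mu>\<^sup>s\<close> with the largest exponent cancel, and those of its
  derivative do not, then a Newton-type estimate gives a root \<open>c \<mu>\<^sup>s (1 + o(1))\<close>. Four such pairs
  \<open>(c, s)\<close> that are distinct account for all roots, and by conjugation the root of a real \<open>c\<close> is
  eventually real. When \<open>c\<close> is purely imaginary the real part is of lower order. It is found from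
  the form \<open>k(\<lambda>) h(\<lambda>) = 2 \<mu>\<^sup>\<gamma> A\<close> of the equation, where \<open>A = \<mu> powr (2 * \<alpha>)\<close>,
  \<open>k(\<lambda>) = \<lambda>\<^sup>2 + 2 \<mu>\<^sup>\<gamma>\<close> and \<open>h(\<lambda>) = \<lambda>\<^sup>2 + \<mu>\<^sup>\<beta> \<lambda> + \<mu> + A\<close>: a nonreal root satisfies the exact identities
  \<open>Re \<lambda> = - \<mu>\<^sup>\<beta> \<mu>\<^sup>\<gamma> A / (\<bar>h\<bar>\<^sup>2 + 2 \<mu>\<^sup>\<gamma> A) = - \<mu>\<^sup>\<beta> \<bar>k\<bar>\<^sup>2 / (2 \<bar>k\<bar>\<^sup>2 + 4 \<mu>\<^sup>\<gamma> A)\<close>,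
  whose right-hand sides need only the leading term of \<open>\<lambda>\<close>. One uses \<open>h\<close> when the leading terms of
  \<open>k\<close> cancel, and \<open>k\<close> when those of \<open>h\<close> do.
\<close>

section \<open>Leading-order asymptotics\<close>

text \<open>From \<open>p' / p = \<Sum> 1 / (x - r i)\<close>.\<close>
lemma nearest_root:
  fixes r :: "'a \<Rightarrow> complex" and x :: complex and I :: "'a set"
  defines "p \<equiv> \<Prod>i\<in>I. [:- r i, 1:]"
  assumes "finite I" "poly (pderiv p) x \<noteq> 0"
  shows "\<exists>i\<in>I. cmod (x - r i) * cmod (poly (pderiv p) x) \<le> card I * cmod (poly p x)"
proof (cases "\<exists>i\<in>I. x = r i")
  case True
  then obtain i where "i \<in> I" "x = r i" by blast
  then have "cmod (x - r i) * cmod (poly (pderiv p) x) \<le> card I * cmod (poly p x)" by simp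
  then show ?thesis using \<open>i \<in> I\<close> by blast
next
  case False
  have ne: "x - r i \<noteq> 0" if "i \<in> I" for i using False that by auto
  have p: "poly p x = (\<Prod>i\<in>I. x - r i)" by (simp add: p_def poly_prod)
  have I: "I \<noteq> {}" using assms(3) by (auto simp: p_def)
  have "poly (pderiv p) x = (\<Sum>i\<in>I. \<Prod>j\<in>I - {i}. x - r j)"
    by (simp add: p_def pderiv_prod poly_sum poly_prod pderiv_pCons)
  also have "\<dots> = (\<Sum>i\<in>I. poly p x / (x - r i))"
    using ne \<open>finite I\<close> by (intro sum.cong refl) (simp add: p prod.remove)
  finally have d: "poly (pderiv p) x = (\<Sum>i\<in>I. poly p x / (x - r i))" .
  show ?thesis
  proof (rule ccontr)
    let ?D = "cmod (poly (pderiv p) x)"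
    assume "\<not> ?thesis"
    then have far: "card I * cmod (poly p x) < cmod (x - r i) * ?D" if "i \<in> I" for i
      using that by (auto simp: not_le)
    have D: "?D > 0" using assms(3) by simp
    have c: "card I > 0" using I \<open>finite I\<close> by (simp add: card_gt_0_iff)
    have "?D \<le> (\<Sum>i\<in>I. cmod (poly p x) / cmod (x - r i))"
      unfolding d using norm_sum[of "\<lambda>i. poly p x / (x - r i)" I] by (simp add: norm_divide)
    also have "\<dots> < (\<Sum>i\<in>I. ?D / card I)"
    proof (rule sum_strict_mono[OF \<open>finite I\<close> I])
      fix i assume "i \<in> I"
      then show "cmod (poly p x) / cmod (x - r i) < ?D / card I"
        using far[of i] ne[of i] c by (simp add: field_simps)
    qed
    also have "\<dots> = ?D" using c by simp
    finally show False by simp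
  qed
qed

lemma poly_quartic_cnj: "poly (quartic m \<alpha> \<beta> \<gamma>) (cnj x) = cnj (poly (quartic m \<alpha> \<beta> \<gamma>) x)"
  by (simp add: quartic_def)

text \<open>The Boolean tells a term that attains the exponent m from one below it, so one
  hypothesis per term serves every balance. For \<open>k \<in> F\<close> with a concrete set F it
  simplifies to a linear equation or inequality.\<close>

definition dominates :: "real \<Rightarrow> real \<Rightarrow> bool \<Rightarrow> bool" where
  "dominates m e b \<longleftrightarrow> (if b then e = m else e < m)"

lemma dominates_simps [simp]:
  "dominates m e True \<longleftrightarrow> e = m" "dominates m e False \<longleftrightarrow> e < m"
  by (simp_all add: dominates_def)

section \<open>Existence of a root near every balanced point\<close>

locale quartic_roots =
  fixes \<mu> :: "nat \<Rightarrow> real" and r :: "nat \<Rightarrow> nat \<Rightarrow> complex" and \<alpha> \<beta> \<gamma> :: real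
  assumes mu_lim: "filterlim \<mu> at_top sequentially"
    and roots: "\<And>n. n \<ge> 1 \<Longrightarrow>
      image_mset (r n) (mset_set {1..4}) = proots (quartic (\<mu> n) \<alpha> \<beta> \<gamma>)"
begin

lemma mu_pos: "\<forall>\<^sub>F n in sequentially. \<mu> n > 0"
  using mu_lim by (simp add: filterlim_at_top_dense)

lemma quartic_eq_prod:
  assumes "n \<ge> 1"
  shows "quartic (\<mu> n) \<alpha> \<beta> \<gamma> = (\<Prod>i\<in>{1..4}. [:- r n i, 1:])"
proof -
  have "quartic (\<mu> n) \<alpha> \<beta> \<gamma> = (\<Prod>x\<in>#proots (quartic (\<mu> n) \<alpha> \<beta> \<gamma>). [:- x, 1:])"
    using complex_poly_decompose_multiset[of "quartic (\<mu> n) \<alpha> \<beta> \<gamma>"] by (simp add: quartic_def)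
  also have "\<dots> = (\<Prod>i\<in>{1..4}. [:- r n i, 1:])"
    by (simp add: roots[OF assms, symmetric] multiset.map_comp comp_def prod_unfold_prod_mset)
  finally show ?thesis .
qed

lemma poly_quartic_eq_0_iff:
  assumes "n \<ge> 1"
  shows "poly (quartic (\<mu> n) \<alpha> \<beta> \<gamma>) x = 0 \<longleftrightarrow> (\<exists>i\<in>{1..4}. x = r n i)"
  by (auto simp: quartic_eq_prod[OF assms] poly_prod prod_zero_iff)

lemma dominates_tendsto:
  assumes "dominates m e b"
  shows "(\<lambda>n. \<mu> n powr (e - m)) \<longlonglongrightarrow> of_bool b"
proof (cases b)
  case True
  have "\<forall>\<^sub>F n in sequentially. \<mu> n powr (e - m) = 1"
    using mu_pos by eventually_elim (use True assms in auto)
  then show ?thesis using True by (simp add: tendsto_eventually)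
next
  case False
  then show ?thesis using assms tendsto_neg_powr[OF _ mu_lim, of "e - m"] by auto
qed

text \<open>Written as a limit, the relation passes to real and imaginary parts by continuity, also
  where one of these parts of c is 0.\<close>

definition follows :: "(nat \<Rightarrow> complex) \<Rightarrow> complex \<Rightarrow> real \<Rightarrow> bool" where
  "follows z c s \<longleftrightarrow> (\<lambda>n. z n / of_real (\<mu> n powr s)) \<longlonglongrightarrow> c"

text \<open>The index j varies with n because \<open>r n\<close> lists the roots in an arbitrary
  order. A nonzero c makes s the true order of the root.\<close>

definition branch :: "complex \<Rightarrow> real \<Rightarrow> bool" where
  "branch c s \<longleftrightarrow> c \<noteq> 0 \<and> (\<exists>j. (\<forall>n. j n \<in> {1..4}) \<and> follows (\<lambda>n. r n (j n)) c s)"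

text \<open>At \<open>c \<mu>\<^sup>s\<close> the quartic is a sum of seven powers of \<open>\<mu>\<close>; \<open>m\<close> is the largest exponent, and \<open>F\<close>
  lists the terms that attain it, numbered by descending power of \<open>\<lambda>\<close>.\<close>
lemma branchI:
  fixes F :: "nat set"
  assumes dom: "dominates m (4*s) (1 \<in> F)" "dominates m (\<beta> + 3*s) (2 \<in> F)"
      "dominates m (1 + 2*s) (3 \<in> F)" "dominates m (2*\<alpha> + 2*s) (4 \<in> F)"
      "dominates m (\<gamma> + 2*s) (5 \<in> F)" "dominates m (\<beta> + \<gamma> + s) (6 \<in> F)"
      "dominates m (1 + \<gamma>) (7 \<in> F)"
    and bal: "c^4 * of_bool (1 \<in> F) + c^3 * of_bool (2 \<in> F)
      + c^2 * (of_bool (3 \<in> F) + of_bool (4 \<in> F) + 2 * of_bool (5 \<in> F))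
      + 2 * c * of_bool (6 \<in> F) + 2 * of_bool (7 \<in> F) = 0"
    and simple: "4 * c^4 * of_bool (1 \<in> F) + 3 * c^3 * of_bool (2 \<in> F)
      + 2 * c^2 * (of_bool (3 \<in> F) + of_bool (4 \<in> F) + 2 * of_bool (5 \<in> F)) + 2 * c * of_bool (6 \<in> F) \<noteq> 0"
  shows "branch c s"
proof -
  define T where "T e n = complex_of_real (\<mu> n powr (e - m))" for e n
  define x where "x n = c * of_real (\<mu> n powr s)" for n
  \<comment> \<open>Up to the factor \<open>\<mu> n powr m\<close>, P is the value of the quartic at
    the trial point \<open>x n\<close>, and D is \<open>x n\<close> times the value of the
    derivative. That extra factor \<open>x n\<close> gives the terms of D the same exponents as
    those of P. \<open>bal\<close> and \<open>simple\<close> are about the limits of P and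
    D.\<close>
  define P where "P n = c^4 * T (4*s) n + c^3 * T (\<beta> + 3*s) n
      + c^2 * (T (1 + 2*s) n + T (2*\<alpha> + 2*s) n + 2 * T (\<gamma> + 2*s) n)
      + 2 * c * T (\<beta> + \<gamma> + s) n + 2 * T (1 + \<gamma>) n" for n
  define D where "D n = 4 * c^4 * T (4*s) n + 3 * c^3 * T (\<beta> + 3*s) n
      + 2 * c^2 * (T (1 + 2*s) n + T (2*\<alpha> + 2*s) n + 2 * T (\<gamma> + 2*s) n)
      + 2 * c * T (\<beta> + \<gamma> + s) n" for n
  define d where "d = 4 * c^4 * of_bool (1 \<in> F) + 3 * c^3 * of_bool (2 \<in> F)
      + 2 * c^2 * (of_bool (3 \<in> F) + of_bool (4 \<in> F) + 2 * of_bool (5 \<in> F)) + 2 * c * of_bool (6 \<in> F)"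
  have d: "d \<noteq> 0" using simple by (simp add: d_def)
  have c: "c \<noteq> 0" using simple by auto
  have T: "T e \<longlonglongrightarrow> of_bool b" if "dominates m e b" for e b
    using tendsto_of_real[OF dominates_tendsto[OF that]] by (cases b) (simp_all add: T_def[abs_def])
  have P_lim: "P \<longlonglongrightarrow> 0"
    unfolding P_def[abs_def] bal[symmetric] by (intro tendsto_intros T dom)
  have D_lim: "D \<longlonglongrightarrow> d"
    unfolding D_def[abs_def] d_def by (intro tendsto_intros T dom)
  have ev_P: "\<forall>\<^sub>F n in sequentially. poly (quartic (\<mu> n) \<alpha> \<beta> \<gamma>) (x n) = of_real (\<mu> n powr m) * P n
      \<and> x n * poly (pderiv (quartic (\<mu> n) \<alpha> \<beta> \<gamma>)) (x n) = of_real (\<mu> n powr m) * D n"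
    using mu_pos
  proof eventually_elim
    case (elim n)
    have 1: "of_real (\<mu> n powr m) * T e n = of_real (\<mu> n powr e)" for e
      using elim by (simp add: T_def flip: of_real_mult powr_add)
    have 2: "\<mu> n powr (4*s) = (\<mu> n powr s) ^ 4" "\<mu> n powr (3*s) = (\<mu> n powr s) ^ 3"
      "\<mu> n powr (2*s) = (\<mu> n powr s) ^ 2"
      using elim powr_powr[of "\<mu> n" s 4] powr_powr[of "\<mu> n" s 3] powr_powr[of "\<mu> n" s 2]
      by (simp_all add: mult.commute)
    have "of_real (\<mu> n powr m) * P n = c^4 * (of_real (\<mu> n powr m) * T (4*s) n)
      + c^3 * (of_real (\<mu> n powr m) * T (\<beta> + 3*s) n)
      + c^2 * (of_real (\<mu> n powr m) * T (1 + 2*s) n + of_real (\<mu> n powr m) * T (2*\<alpha> + 2*s) n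
         + 2 * (of_real (\<mu> n powr m) * T (\<gamma> + 2*s) n))
      + 2 * c * (of_real (\<mu> n powr m) * T (\<beta> + \<gamma> + s) n) + 2 * (of_real (\<mu> n powr m) * T (1 + \<gamma>) n)"
      by (simp add: P_def algebra_simps)
    also have "\<dots> = poly (quartic (\<mu> n) \<alpha> \<beta> \<gamma>) (x n)"
      unfolding 1 using elim
      by (simp add: x_def quartic_def powr_add 2) algebra
    finally have A: "of_real (\<mu> n powr m) * P n = poly (quartic (\<mu> n) \<alpha> \<beta> \<gamma>) (x n)" .
    have "of_real (\<mu> n powr m) * D n = 4 * c^4 * (of_real (\<mu> n powr m) * T (4*s) n)
      + 3 * c^3 * (of_real (\<mu> n powr m) * T (\<beta> + 3*s) n)
      + 2 * c^2 * (of_real (\<mu> n powr m) * T (1 + 2*s) n + of_real (\<mu> n powr m) * T (2*\<alpha> + 2*s) n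
         + 2 * (of_real (\<mu> n powr m) * T (\<gamma> + 2*s) n))
      + 2 * c * (of_real (\<mu> n powr m) * T (\<beta> + \<gamma> + s) n)"
      by (simp add: D_def algebra_simps)
    also have "\<dots> = x n * poly (pderiv (quartic (\<mu> n) \<alpha> \<beta> \<gamma>)) (x n)"
      unfolding 1 using elim
      by (simp add: x_def quartic_def pderiv_pCons powr_add 2) algebra
    finally show ?case using A by simp
  qed
  have ev_D: "\<forall>\<^sub>F n in sequentially. D n \<noteq> 0"
    using tendsto_imp_eventually_ne[OF D_lim d] .
  \<comment> \<open>The condition stands below the quantifier, so that an index in
    \<open>{1..4}\<close> is chosen for every n, also where the derivative vanishes.\<close>
  have "\<forall>n. \<exists>i\<in>{1..4}. poly (pderiv (quartic (\<mu> n) \<alpha> \<beta> \<gamma>)) (x n) \<noteq> 0 \<and> n \<ge> 1 \<longrightarrow>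
      cmod (x n - r n i) * cmod (poly (pderiv (quartic (\<mu> n) \<alpha> \<beta> \<gamma>)) (x n))
        \<le> 4 * cmod (poly (quartic (\<mu> n) \<alpha> \<beta> \<gamma>) (x n))"
    using nearest_root[of "{1..4::nat}"] by (force simp: quartic_eq_prod)
  then obtain j where j: "\<And>n. j n \<in> {1..4}"
    and near: "\<And>n. \<lbrakk>poly (pderiv (quartic (\<mu> n) \<alpha> \<beta> \<gamma>)) (x n) \<noteq> 0; n \<ge> 1\<rbrakk> \<Longrightarrow>
      cmod (x n - r n (j n)) * cmod (poly (pderiv (quartic (\<mu> n) \<alpha> \<beta> \<gamma>)) (x n))
        \<le> 4 * cmod (poly (quartic (\<mu> n) \<alpha> \<beta> \<gamma>) (x n))"
    by metis
  have "\<forall>\<^sub>F n in sequentially. cmod (r n (j n) / of_real (\<mu> n powr s) - c) \<le> 4 * cmod c * cmod (P n / D n)"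
    using mu_pos ev_P ev_D eventually_ge_at_top[of 1]
  proof eventually_elim
    case (elim n)
    let ?Q = "poly (quartic (\<mu> n) \<alpha> \<beta> \<gamma>) (x n)"
    let ?Q' = "poly (pderiv (quartic (\<mu> n) \<alpha> \<beta> \<gamma>)) (x n)"
    have "x n \<noteq> 0" using c elim by (simp add: x_def)
    have Q': "?Q' \<noteq> 0" using elim by auto
    \<comment> \<open>Expanding by \<open>cmod (x n)\<close> turns the Newton quotient into P / D,
      in which \<open>\<mu> n powr m\<close> cancels.\<close>
    have "cmod (x n - r n (j n)) \<le> 4 * (cmod ?Q / cmod ?Q')"
      using near[OF Q' elim(4)] Q' by (simp add: field_simps)
    also have "cmod ?Q / cmod ?Q' = cmod (x n) * (cmod (?Q) / cmod (x n * ?Q'))"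
      using \<open>x n \<noteq> 0\<close> by (simp add: norm_mult)
    also have "\<dots> = cmod c * \<mu> n powr s * cmod (P n / D n)"
      using elim by (simp add: norm_mult norm_divide x_def)
    finally have "cmod (x n - r n (j n)) / \<mu> n powr s \<le> 4 * cmod c * cmod (P n / D n)"
      using elim by (simp add: field_simps)
    moreover have "r n (j n) / of_real (\<mu> n powr s) - c = - (x n - r n (j n)) / of_real (\<mu> n powr s)"
      using elim by (simp add: x_def field_simps)
    ultimately show ?case by (simp add: norm_divide norm_minus_commute)
  qed
  note bound = this
  have "(\<lambda>n. 4 * cmod c * cmod (P n / D n)) \<longlonglongrightarrow> 4 * cmod c * cmod (0 / d)"
    by (intro tendsto_intros P_lim D_lim d)
  then have "(\<lambda>n. 4 * cmod c * cmod (P n / D n)) \<longlonglongrightarrow> 0" by simp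
  from tendsto_sandwich[OF _ bound tendsto_const this]
  have "(\<lambda>n. cmod (r n (j n) / of_real (\<mu> n powr s) - c)) \<longlonglongrightarrow> 0"
    by simp
  then have "(\<lambda>n. r n (j n) / of_real (\<mu> n powr s) - c) \<longlonglongrightarrow> 0"
    by (rule tendsto_norm_zero_cancel)
  then have "follows (\<lambda>n. r n (j n)) c s"
    unfolding follows_def by (rule LIM_zero_cancel)
  then show ?thesis unfolding branch_def using j c by (intro conjI exI[of _ j]) simp_all
qed

section \<open>Separation of leading terms and numbering of the roots\<close>

lemma follows_Re:
  assumes "follows z c s" "Re c \<noteq> 0"
  shows "(\<lambda>n. Re (z n)) \<sim>[sequentially] (\<lambda>n. Re c * \<mu> n powr s)"
proof (rule asymp_equivI'_const)
  show "(\<lambda>n. Re (z n) / \<mu> n powr s) \<longlonglongrightarrow> Re c"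
    using tendsto_Re[OF assms(1)[unfolded follows_def]] by simp
qed (rule assms(2))

lemma follows_Im:
  assumes "follows z c s" "Im c \<noteq> 0"
  shows "(\<lambda>n. Im (z n)) \<sim>[sequentially] (\<lambda>n. Im c * \<mu> n powr s)"
proof (rule asymp_equivI'_const)
  show "(\<lambda>n. Im (z n) / \<mu> n powr s) \<longlonglongrightarrow> Im c"
    using tendsto_Im[OF assms(1)[unfolded follows_def]] by simp
qed (rule assms(2))

lemma follows_asymp_equiv:
  assumes "follows z c s" "c \<noteq> 0"
  shows "z \<sim>[sequentially] (\<lambda>n. c * of_real (\<mu> n powr s))"
  using assms by (intro asymp_equivI'_const) (auto simp: follows_def)

lemma follows_cnj: "follows z c s \<Longrightarrow> follows (\<lambda>n. cnj (z n)) (cnj c) s"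
  unfolding follows_def by (drule tendsto_cnj) simp

lemma follows_cong:
  assumes "\<forall>\<^sub>F n in sequentially. z n = w n"
  shows "follows z c s \<longleftrightarrow> follows w c s"
  unfolding follows_def by (intro tendsto_cong eventually_mono[OF assms]) simp

text \<open>After division by the larger of the two powers the limits differ: for equal exponents
  they are c and c'; otherwise the sequence of smaller exponent tends to 0 and the other to a
  nonzero number.\<close>

lemma follows_eventually_ne:
  assumes "follows z c s" "follows w c' s'" "c \<noteq> 0" "c' \<noteq> 0" "(c, s) \<noteq> (c', s')"
  shows "\<forall>\<^sub>F n in sequentially. z n \<noteq> w n"
proof -
  have *: "\<forall>\<^sub>F n in sequentially. z n \<noteq> w n"
    if z: "follows z c s" and w: "follows w c' s'" and "c' \<noteq> 0" "(c, s) \<noteq> (c', s')" "s \<le> s'"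
    for z w c s c' s'
  proof -
    have "(\<lambda>n. z n / of_real (\<mu> n powr s) * of_real (\<mu> n powr (s - s'))) \<longlonglongrightarrow> c * of_real (of_bool (s = s'))"
      using z \<open>s \<le> s'\<close> unfolding follows_def
      by (intro tendsto_mult tendsto_of_real dominates_tendsto) (auto simp: dominates_def)
    then have "(\<lambda>n. z n / of_real (\<mu> n powr s')) \<longlonglongrightarrow> c * of_real (of_bool (s = s'))"
    proof (rule Lim_transform_eventually)
      show "\<forall>\<^sub>F n in sequentially. z n / of_real (\<mu> n powr s) * of_real (\<mu> n powr (s - s')) =
          z n / of_real (\<mu> n powr s')"
        using mu_pos by eventually_elim (simp add: powr_diff)
    qed
    from tendsto_diff[OF this w[unfolded follows_def]]
    have "\<forall>\<^sub>F n in sequentially. z n / of_real (\<mu> n powr s') - w n / of_real (\<mu> n powr s') \<noteq> 0"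
      by (rule tendsto_imp_eventually_ne) (use that in auto)
    then show ?thesis by eventually_elim auto
  qed
  show ?thesis
  proof (cases "s \<le> s'")
    case True
    then show ?thesis using *[of z c s w c' s'] assms by blast
  next
    case False
    then have "\<forall>\<^sub>F n in sequentially. w n \<noteq> z n"
      using *[of w c' s' z c s] assms by auto
    then show ?thesis by eventually_elim auto
  qed
qed

text \<open>Collects what is used later about a numbered root. Everything is asymptotic, since for
  small n the numbering carries no information.\<close>

definition tracks :: "(nat \<Rightarrow> complex) \<Rightarrow> complex \<Rightarrow> real \<Rightarrow> bool" where
  "tracks z c s \<longleftrightarrow> follows z c s \<and>
     (\<forall>\<^sub>F n in sequentially. poly (quartic (\<mu> n) \<alpha> \<beta> \<gamma>) (z n) = 0) \<and>
     (Im c = 0 \<longrightarrow> (\<forall>\<^sub>F n in sequentially. Im (z n) = 0))"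

text \<open>Sequences with different leading terms are eventually different, so the four indices are
  eventually distinct and exhaust \<open>{1..4}\<close>. If \<open>C i\<close> is real, the
  conjugate of the i-th root is a root with the same leading term, hence the same root.\<close>

lemma numbering:
  assumes branch: "\<And>i. i \<in> {1..4::nat} \<Longrightarrow> branch (C i) (S i)"
    and inj: "inj_on (\<lambda>i. (C i, S i)) {1..4}"
  shows "\<exists>\<sigma>. (\<forall>n. \<sigma> n permutes {1..4}) \<and> (\<forall>i\<in>{1..4}. tracks (\<lambda>n. r n (\<sigma> n i)) (C i) (S i))"
proof -
  have C: "C i \<noteq> 0" if "i \<in> {1..4}" for i using branch[OF that] by (simp add: branch_def)
  have "\<forall>i\<in>{1..4}. \<exists>j. (\<forall>n. j n \<in> {1..4}) \<and> follows (\<lambda>n. r n (j n)) (C i) (S i)"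
    using branch by (auto simp: branch_def)
  from bchoice[OF this] obtain J where J: "\<And>i n. i \<in> {1..4} \<Longrightarrow> J i n \<in> {1..4}"
    and fol: "\<And>i. i \<in> {1..4} \<Longrightarrow> follows (\<lambda>n. r n (J i n)) (C i) (S i)"
    by blast
  have ne: "\<forall>\<^sub>F n in sequentially. \<forall>i\<in>{1..4}. \<forall>k\<in>{1..4}. i \<noteq> k \<longrightarrow> r n (J i n) \<noteq> r n (J k n)"
  proof (intro eventually_ball_finite ballI finite_atLeastAtMost)
    fix i k :: nat assume ik: "i \<in> {1..4}" "k \<in> {1..4}"
    show "\<forall>\<^sub>F n in sequentially. i \<noteq> k \<longrightarrow> r n (J i n) \<noteq> r n (J k n)"
    proof (cases "i = k")
      case False
      then have "(C i, S i) \<noteq> (C k, S k)" using inj_onD[OF inj _ ik] by blast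
      from follows_eventually_ne[OF fol[OF ik(1)] fol[OF ik(2)] C[OF ik(1)] C[OF ik(2)] this]
      show ?thesis by eventually_elim simp
    qed simp
  qed
  have surj: "\<forall>\<^sub>F n in sequentially. bij_betw (\<lambda>i. J i n) {1..4} {1..4}"
    using ne
  proof eventually_elim
    case (elim n)
    then have "inj_on (\<lambda>i. J i n) {1..4}" by (force simp: inj_on_def)
    moreover have "(\<lambda>i. J i n) ` {1..4} \<subseteq> {1..4}" using J by blast
    ultimately show ?case by (simp add: bij_betw_def endo_inj_surj)
  qed
  \<comment> \<open>The identity fills in the n at which the indices are not yet distinct; outside
    \<open>{1..4}\<close> every point is fixed, as \<open>permutes\<close> demands.\<close>
  define \<sigma> where "\<sigma> n =
    (if bij_betw (\<lambda>i. J i n) {1..4} {1..4} then \<lambda>i. if i \<in> {1..4} then J i n else i else id)" for n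
  have perm: "\<sigma> n permutes {1..4}" for n
  proof (cases "bij_betw (\<lambda>i. J i n) {1..4} {1..4}")
    case True
    then have "bij_betw (\<sigma> n) {1..4} {1..4}"
      by (subst bij_betw_cong[of _ _ "\<lambda>i. J i n"]) (auto simp: \<sigma>_def)
    then show ?thesis using True by (intro bij_imp_permutes) (auto simp: \<sigma>_def)
  qed (simp add: \<sigma>_def permutes_id)
  have eq: "\<forall>\<^sub>F n in sequentially. r n (\<sigma> n i) = r n (J i n)" if "i \<in> {1..4}" for i
    using surj by eventually_elim (use that in \<open>simp add: \<sigma>_def\<close>)
  have "tracks (\<lambda>n. r n (\<sigma> n i)) (C i) (S i)" if i: "i \<in> {1..4}" for i
    unfolding tracks_def
  proof (intro conjI impI)
    show "follows (\<lambda>n. r n (\<sigma> n i)) (C i) (S i)"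
      using follows_cong[OF eq[OF i]] fol[OF i] by blast
    show "\<forall>\<^sub>F n in sequentially. poly (quartic (\<mu> n) \<alpha> \<beta> \<gamma>) (r n (\<sigma> n i)) = 0"
      using eventually_ge_at_top[of 1]
    proof eventually_elim
      case (elim n)
      have "\<sigma> n i \<in> {1..4}" using permutes_in_image[OF perm] i by blast
      then show ?case using elim by (auto simp: poly_quartic_eq_0_iff)
    qed
    assume "Im (C i) = 0"
    then have "cnj (C i) = C i" by (simp add: complex_eq_iff)
    \<comment> \<open>With the leading term of branch i, the conjugate eventually avoids the three
      other branches.\<close>
    then have cnj: "follows (\<lambda>n. cnj (r n (J i n))) (C i) (S i)"
      using follows_cnj[OF fol[OF i]] by simp
    have "\<forall>\<^sub>F n in sequentially. \<forall>k\<in>{1..4}. k \<noteq> i \<longrightarrow> cnj (r n (J i n)) \<noteq> r n (J k n)"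
    proof (intro eventually_ball_finite ballI finite_atLeastAtMost)
      fix k :: nat assume k: "k \<in> {1..4}"
      show "\<forall>\<^sub>F n in sequentially. k \<noteq> i \<longrightarrow> cnj (r n (J i n)) \<noteq> r n (J k n)"
      proof (cases "i = k")
        case False
        then have "(C i, S i) \<noteq> (C k, S k)" using inj_onD[OF inj _ i k] by blast
        from follows_eventually_ne[OF cnj fol[OF k] C[OF i] C[OF k] this]
        show ?thesis by eventually_elim simp
      qed simp
    qed
    then show "\<forall>\<^sub>F n in sequentially. Im (r n (\<sigma> n i)) = 0"
      using surj eventually_ge_at_top[of 1] eq[OF i]
    proof eventually_elim
      case (elim n)
      have "poly (quartic (\<mu> n) \<alpha> \<beta> \<gamma>) (r n (J i n)) = 0"
        using elim J[OF i] by (auto simp: poly_quartic_eq_0_iff)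
      then have "poly (quartic (\<mu> n) \<alpha> \<beta> \<gamma>) (cnj (r n (J i n))) = 0"
        by (simp add: poly_quartic_cnj)
      then obtain l where "l \<in> {1..4}" "cnj (r n (J i n)) = r n l"
        using elim by (auto simp: poly_quartic_eq_0_iff)
      \<comment> \<open>By surjectivity of the indices the conjugate root lies on one of the four
        branches, which can then only be branch i.\<close>
      moreover from \<open>l \<in> {1..4}\<close> have "l \<in> (\<lambda>k. J k n) ` {1..4}"
        by (simp only: bij_betw_imp_surj_on[OF elim(2)])
      then obtain k where "k \<in> {1..4}" "l = J k n" by (rule imageE)
      ultimately have k: "k \<in> {1..4}" "cnj (r n (J i n)) = r n (J k n)" by simp_all
      have "k = i"
      proof (rule ccontr)
        assume "k \<noteq> i"
        then have "cnj (r n (J i n)) \<noteq> r n (J k n)" using elim(1) k(1) by blast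
        then show False using k(2) by contradiction
      qed
      then have "cnj (r n (J i n)) = r n (J i n)" using k(2) by simp
      then show ?case using elim(4) by (simp add: complex_eq_iff)
    qed
  qed
  then show ?thesis using perm by blast
qed

section \<open>Pairs of branches\<close>

definition root_pair ::
  "((nat \<Rightarrow> real) \<Rightarrow> (nat \<Rightarrow> complex) \<Rightarrow> (nat \<Rightarrow> complex) \<Rightarrow> bool) \<Rightarrow>
    complex \<Rightarrow> real \<Rightarrow> complex \<Rightarrow> real \<Rightarrow> bool" where
  "root_pair A c s c' s' \<longleftrightarrow> branch c s \<and> branch c' s' \<and>
     (\<forall>z w. tracks z c s \<longrightarrow> tracks w c' s' \<longrightarrow> A \<mu> z w)"

text \<open>A \<open>root_pair\<close> speaks of all sequences that track its two branches and so
  does not refer to the numbering, which is constructed only here. Distinctness of the four leading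
  terms is the injectivity that \<open>numbering\<close> asks for.\<close>

lemma roots_asympI:
  assumes pairs: "root_pair A c1 s1 c2 s2" "root_pair B c3 s3 c4 s4"
    and dist: "distinct [(c1, s1), (c2, s2), (c3, s3), (c4, s4)]"
  shows "roots_asymp \<mu> r A B"
proof -
  have branches: "branch c1 s1" "branch c2 s2" "branch c3 s3" "branch c4 s4"
    and A: "\<And>z w. tracks z c1 s1 \<Longrightarrow> tracks w c2 s2 \<Longrightarrow> A \<mu> z w"
    and B: "\<And>z w. tracks z c3 s3 \<Longrightarrow> tracks w c4 s4 \<Longrightarrow> B \<mu> z w"
    using pairs unfolding root_pair_def by blast+
  \<comment> \<open>The roots are numbered from 1, list positions from 0.\<close>
  define C where "C i = [c1, c2, c3, c4] ! (i - 1)" for i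
  define S where "S i = [s1, s2, s3, s4] ! (i - 1)" for i
  have I: "{1..4} = {1, 2, 3, 4::nat}" by auto
  have CS: "C 1 = c1" "C 2 = c2" "C 3 = c3" "C 4 = c4" "S 1 = s1" "S 2 = s2" "S 3 = s3" "S 4 = s4"
    by (simp_all add: C_def S_def)
  have "branch (C i) (S i)" if "i \<in> {1..4}" for i
    using that branches unfolding I by (auto simp: CS simp del: One_nat_def)
  moreover have "inj_on (\<lambda>i. (C i, S i)) {1..4}"
    using dist unfolding I by (auto simp: inj_on_def CS simp del: One_nat_def)
  ultimately obtain \<sigma> where \<sigma>: "\<And>n. \<sigma> n permutes {1..4}"
    and tr: "\<And>i. i \<in> {1..4} \<Longrightarrow> tracks (\<lambda>n. r n (\<sigma> n i)) (C i) (S i)"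
    using numbering[of C S] by blast
  show ?thesis unfolding roots_asymp_def
    by (intro exI[of _ \<sigma>] conjI A B allI impI \<sigma>) (use tr[of 1] tr[of 2] tr[of 3] tr[of 4] in \<open>simp_all only: CS, simp_all\<close>)
qed

text \<open>The coefficients are real, so the conjugate of each root on the branch is again one of
  the listed roots, at an index that depends on n.\<close>

lemma branch_cnj:
  assumes "branch (Complex a d) s"
  shows "branch (Complex a (- d)) s"
proof -
  obtain j where c: "Complex a d \<noteq> 0" and j: "\<And>n. j n \<in> {1..4}"
    and fol: "follows (\<lambda>n. r n (j n)) (Complex a d) s"
    using assms unfolding branch_def by blast
  have "\<exists>i\<in>{1..4}. r n i = cnj (r n (j n))" if "n \<ge> 1" for n
  proof -
    have "poly (quartic (\<mu> n) \<alpha> \<beta> \<gamma>) (cnj (r n (j n))) = 0"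
      using poly_quartic_eq_0_iff[OF that, of "r n (j n)"] j[of n] by (auto simp: poly_quartic_cnj)
    then show ?thesis using poly_quartic_eq_0_iff[OF that] by metis
  qed
  then have "\<forall>n. \<exists>i\<in>{1..4}. n \<ge> 1 \<longrightarrow> r n i = cnj (r n (j n))" using j by blast
  then obtain k where k: "\<And>n. k n \<in> {1..4}" "\<And>n. n \<ge> 1 \<Longrightarrow> r n (k n) = cnj (r n (j n))"
    by metis
  have "follows (\<lambda>n. cnj (r n (j n))) (Complex a (- d)) s"
    using follows_cnj[OF fol] by (simp add: complex_cnj)
  moreover have "\<forall>\<^sub>F n in sequentially. r n (k n) = cnj (r n (j n))"
    using eventually_ge_at_top[of 1] by eventually_elim (rule k)
  ultimately have "follows (\<lambda>n. r n (k n)) (Complex a (- d)) s"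
    by (simp only: follows_cong)
  then show ?thesis unfolding branch_def using k(1) c by (intro conjI exI[of _ k]) (simp_all add: complex_eq_iff)
qed

text \<open>Being asymptotic to 0 means being eventually 0, which is the last clause of
  \<open>tracks\<close> for a real coefficient.\<close>

lemma real_pairI:
  assumes "branch (of_real c) s" "branch (of_real d) t" "c \<noteq> 0" "d \<noteq> 0"
  shows "root_pair (real_pair c s d t) (of_real c) s (of_real d) t"
  unfolding root_pair_def real_pair_def
proof (intro conjI allI impI assms)
  fix z w assume z: "tracks z (of_real c) s" and w: "tracks w (of_real d) t"
  show "(\<lambda>n. Re (z n)) \<sim>[sequentially] (\<lambda>n. c * \<mu> n powr s)"
    using follows_Re[of z "of_real c" s] z \<open>c \<noteq> 0\<close> unfolding tracks_def by simp
  show "(\<lambda>n. Re (w n)) \<sim>[sequentially] (\<lambda>n. d * \<mu> n powr t)"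
    using follows_Re[of w "of_real d" t] w \<open>d \<noteq> 0\<close> unfolding tracks_def by simp
  show "(\<lambda>n. Im (z n)) \<sim>[sequentially] (\<lambda>n. 0)" "(\<lambda>n. Im (w n)) \<sim>[sequentially] (\<lambda>n. 0)"
    using z w unfolding tracks_def asymp_equiv_0_right_iff by simp_all
qed

lemma cplx_pairI:
  assumes "branch (Complex c d) s"
  shows "root_pair (cplx_pair c d s) (Complex c d) s (Complex c (- d)) s"
  unfolding root_pair_def cplx_pair_def
proof (intro conjI allI impI assms branch_cnj)
  fix z w assume z: "tracks z (Complex c d) s" and w: "tracks w (Complex c (- d)) s"
  have "Complex c d \<noteq> 0" "Complex c (- d) \<noteq> 0"
    using assms by (simp_all add: branch_def complex_eq_iff)
  then show "z \<sim>[sequentially] (\<lambda>n. Complex c d * of_real (\<mu> n powr s))"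
    and "w \<sim>[sequentially] (\<lambda>n. Complex c (- d) * of_real (\<mu> n powr s))"
    using z w follows_asymp_equiv unfolding tracks_def by simp_all
qed

text \<open>When neither part of the coefficient vanishes, both parts have the order of the root.
  The separate t admits an exponent that is written differently but equals s in the region.\<close>

lemma sep_pairI:
  assumes "branch (Complex c d) s" "t = s" "c \<noteq> 0" "d \<noteq> 0"
  shows "root_pair (sep_pair c t d s) (Complex c d) s (Complex c (- d)) s"
  unfolding root_pair_def sep_pair_def
proof (intro conjI allI impI assms branch_cnj)
  fix z w assume z: "tracks z (Complex c d) s" and w: "tracks w (Complex c (- d)) s"
  show "(\<lambda>n. Re (z n)) \<sim>[sequentially] (\<lambda>n. c * \<mu> n powr t)"
    "(\<lambda>n. Im (z n)) \<sim>[sequentially] (\<lambda>n. d * \<mu> n powr s)"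
    using follows_Re[of z "Complex c d" s] follows_Im[of z "Complex c d" s] z assms
    unfolding tracks_def by simp_all
  show "(\<lambda>n. Re (w n)) \<sim>[sequentially] (\<lambda>n. c * \<mu> n powr t)"
    "(\<lambda>n. Im (w n)) \<sim>[sequentially] (\<lambda>n. - d * \<mu> n powr s)"
    using follows_Re[of w "Complex c (- d)" s] follows_Im[of w "Complex c (- d)" s] w assms
    unfolding tracks_def by simp_all
qed

section \<open>Real parts of roots near the imaginary axis\<close>

text \<open>Both identities come from multiplying \<open>k * h = 2 * G * A\<close> by a conjugate and comparing
  imaginary parts.\<close>
lemma nonreal_root_Re:
  fixes m A G B :: real and z :: complex
  defines "k \<equiv> z\<^sup>2 + of_real (2 * G)"
    and "h \<equiv> z\<^sup>2 + of_real B * z + of_real m + of_real A"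
  assumes "k * (z\<^sup>2 + of_real B * z + of_real m) + of_real A * z\<^sup>2 = 0" and "Im z \<noteq> 0"
  shows "Re z * ((cmod h)\<^sup>2 + 2 * G * A) = - (G * A * B)"
    and "Re z * (2 * (cmod k)\<^sup>2 + 4 * G * A) = - (B * (cmod k)\<^sup>2)"
proof -
  \<comment> \<open>Passing to h adds \<open>k * A\<close> to the product, and
    \<open>k * A - A * z^2 = 2 * G * A\<close>.\<close>
  have kh: "k * h = of_real (2 * G * A)"
    using assms(3) by (simp add: k_def h_def algebra_simps)
  have "k * of_real ((cmod h)\<^sup>2) = of_real (2 * G * A) * cnj h"
    unfolding kh[symmetric] complex_norm_square by simp
  \<comment> \<open>Here \<open>Im k = 2 * Re z * Im z\<close> and
    \<open>Im h = (2 * Re z + B) * Im z\<close>, so \<open>Im z\<close> is a common factor.\<close>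
  from arg_cong[OF this, of Im]
  have "Im z * (Re z * ((cmod h)\<^sup>2 + 2 * G * A)) = Im z * (- (G * A * B))"
    by (simp add: k_def h_def power2_eq_square algebra_simps)
  then show "Re z * ((cmod h)\<^sup>2 + 2 * G * A) = - (G * A * B)"
    unfolding mult_left_cancel[OF \<open>Im z \<noteq> 0\<close>] .
  have "h * of_real ((cmod k)\<^sup>2) = of_real (2 * G * A) * cnj k"
    unfolding kh[symmetric] complex_norm_square by simp
  from arg_cong[OF this, of Im]
  have "Im z * (Re z * (2 * (cmod k)\<^sup>2 + 4 * G * A)) = Im z * (- (B * (cmod k)\<^sup>2))"
    by (simp add: k_def h_def power2_eq_square algebra_simps)
  then show "Re z * (2 * (cmod k)\<^sup>2 + 4 * G * A) = - (B * (cmod k)\<^sup>2)"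
    unfolding mult_left_cancel[OF \<open>Im z \<noteq> 0\<close>] .
qed

text \<open>Supplies the hypotheses of \<open>nonreal_root_Re\<close>; the imaginary part is
  eventually nonzero because its quotient by \<open>\<mu> n powr s\<close> tends to d.\<close>

lemma tracks_nonreal_root:
  assumes "tracks z (Complex 0 d) s" "d \<noteq> 0"
  shows "\<forall>\<^sub>F n in sequentially.
    ((z n)\<^sup>2 + of_real (2 * \<mu> n powr \<gamma>)) * ((z n)\<^sup>2 + of_real (\<mu> n powr \<beta>) * z n + of_real (\<mu> n))
      + of_real (\<mu> n powr (2*\<alpha>)) * (z n)\<^sup>2 = 0 \<and> Im (z n) \<noteq> 0"
proof -
  have "(\<lambda>n. Im (z n) / \<mu> n powr s) \<longlonglongrightarrow> Im (Complex 0 d)"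
    using assms(1) tendsto_Im[of "\<lambda>n. z n / of_real (\<mu> n powr s)"]
    unfolding tracks_def follows_def by fastforce
  then have "\<forall>\<^sub>F n in sequentially. Im (z n) / \<mu> n powr s \<noteq> 0"
    by (rule tendsto_imp_eventually_ne) (simp add: assms)
  moreover have "\<forall>\<^sub>F n in sequentially. poly (quartic (\<mu> n) \<alpha> \<beta> \<gamma>) (z n) = 0"
    using assms(1) unfolding tracks_def by blast
  ultimately show ?thesis using mu_pos
  proof eventually_elim
    case (elim n)
    have "0 = poly (quartic (\<mu> n) \<alpha> \<beta> \<gamma>) (z n)" using elim by simp
    also have "\<dots> = ((z n)\<^sup>2 + of_real (2 * \<mu> n powr \<gamma>)) * ((z n)\<^sup>2 + of_real (\<mu> n powr \<beta>) * z n + of_real (\<mu> n))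
      + of_real (\<mu> n powr (2*\<alpha>)) * (z n)\<^sup>2"
      using elim(3) by (simp add: quartic_def powr_add) algebra
    finally show ?case using elim by auto
  qed
qed

lemma dominates_scaled_tendsto:
  assumes "dominates m e b"
  shows "(\<lambda>n. \<mu> n powr e / \<mu> n powr m) \<longlonglongrightarrow> of_bool b"
  using dominates_tendsto[OF assms] by (simp add: powr_diff)

text \<open>The monomial has exponent \<open>a + k * s\<close>, and its limit relative to exponent m
  depends on whether it attains m. The real k stands beside i to keep that exponent free of
  casts.\<close>

lemma follows_scaled:
  assumes "follows z c s" "dominates m (a + k * s) b" "k = real i"
  shows "(\<lambda>n. of_real (\<mu> n powr a) * z n ^ i / of_real (\<mu> n powr m)) \<longlonglongrightarrow> c ^ i * of_real (of_bool b)"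
proof (rule Lim_transform_eventually)
  show "(\<lambda>n. (z n / of_real (\<mu> n powr s)) ^ i * of_real (\<mu> n powr (a + k * s - m)))
      \<longlonglongrightarrow> c ^ i * of_real (of_bool b)"
    using assms(1) unfolding follows_def by (intro tendsto_intros dominates_tendsto assms)
  show "\<forall>\<^sub>F n in sequentially. (z n / of_real (\<mu> n powr s)) ^ i * of_real (\<mu> n powr (a + k * s - m)) =
      of_real (\<mu> n powr a) * z n ^ i / of_real (\<mu> n powr m)"
    using mu_pos
  proof eventually_elim
    case (elim n)
    have "(\<mu> n powr s) ^ i = \<mu> n powr (k * s)"
      using elim by (simp add: powr_power assms(3))
    then have "of_real (\<mu> n powr (k * s)) = complex_of_real (\<mu> n powr s) ^ i"
      by (simp flip: of_real_power)
    then show ?case using elim by (simp add: powr_add powr_diff power_divide)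
  qed
qed

text \<open>The exponent \<open>m\<close> bounds the terms of \<open>h\<close> and also \<open>\<alpha> + \<gamma>/2\<close>, so \<open>h\<close> may have order below \<open>m\<close>
  when \<open>b5\<close> holds.\<close>
lemma Re_asymp_via_h:
  assumes z: "tracks z (Complex 0 d) s" and d: "d \<noteq> 0"
    and dom: "dominates m (2*s) b1" "dominates m (\<beta> + s) b2" "dominates m 1 b3" "dominates m (2*\<alpha>) b4"
      "dominates (2*m) (2*\<alpha> + \<gamma>) b5"
    and D: "D = (of_bool b3 + of_bool b4 - d\<^sup>2 * of_bool b1)\<^sup>2 + d\<^sup>2 * of_bool b2 + 2 * of_bool b5" "D \<noteq> 0"
    and t: "t = 2*\<alpha> + \<beta> + \<gamma> - 2*m"
  shows "(\<lambda>n. Re (z n)) \<sim>[sequentially] (\<lambda>n. - 1 / D * \<mu> n powr t)"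
proof (rule asymp_equivI'_const)
  have fol: "follows z (Complex 0 d) s" using z unfolding tracks_def by blast
  define h where "h n = (z n)\<^sup>2 + of_real (\<mu> n powr \<beta>) * z n + of_real (\<mu> n) + of_real (\<mu> n powr (2*\<alpha>))" for n
  \<comment> \<open>The factors \<open>\<mu> n powr 0\<close> and \<open>z n ^ 1\<close> bring the
    terms into the form of \<open>follows_scaled\<close>.\<close>
  define hs where "hs n = of_real (\<mu> n powr 0) * z n ^ 2 / of_real (\<mu> n powr m)
    + of_real (\<mu> n powr \<beta>) * z n ^ 1 / of_real (\<mu> n powr m)
    + of_real (\<mu> n powr 1 / \<mu> n powr m) + of_real (\<mu> n powr (2*\<alpha>) / \<mu> n powr m)" for n
  define H where "H = Complex 0 d ^ 2 * of_real (of_bool b1) + Complex 0 d ^ 1 * of_real (of_bool b2)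
    + of_real (of_bool b3) + of_real (of_bool b4)"
  have "hs \<longlonglongrightarrow> H"
    unfolding hs_def[abs_def] H_def
    by (intro tendsto_add tendsto_of_real follows_scaled[OF fol, where k = 2] follows_scaled[OF fol, where k = 1]
        dominates_scaled_tendsto) (use dom in simp_all)
  \<comment> \<open>At an imaginary leading term only the damping term of h is imaginary, hence the
    sum of two squares in D.\<close>
  have "H = Complex (of_bool b3 + of_bool b4 - d\<^sup>2 * of_bool b1) (d * of_bool b2)"
    by (simp add: H_def complex_eq_iff power2_eq_square)
  then have "(cmod H)\<^sup>2 + 2 * of_bool b5 = D"
    by (simp add: D(1) cmod_power2 power_mult_distrib)
  moreover from \<open>hs \<longlonglongrightarrow> H\<close>
  have "(\<lambda>n. (cmod (hs n))\<^sup>2 + 2 * (\<mu> n powr (2*\<alpha> + \<gamma>) / \<mu> n powr (2*m)))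
    \<longlonglongrightarrow> (cmod H)\<^sup>2 + 2 * of_bool b5"
    by (intro tendsto_intros dominates_scaled_tendsto dom)
  \<comment> \<open>The exact identity is divided by \<open>\<mu> n powr (2*m)\<close> above and
    below, which leaves the exponent t.\<close>
  ultimately have "(\<lambda>n. - 1 / ((cmod (hs n))\<^sup>2 + 2 * (\<mu> n powr (2*\<alpha> + \<gamma>) / \<mu> n powr (2*m)))) \<longlonglongrightarrow> - 1 / D"
    using D(2) by (intro tendsto_divide tendsto_const) simp_all
  then show "(\<lambda>n. Re (z n) / \<mu> n powr t) \<longlonglongrightarrow> - 1 / D"
  proof (rule Lim_transform_eventually)
    show "\<forall>\<^sub>F n in sequentially. - 1 / ((cmod (hs n))\<^sup>2 + 2 * (\<mu> n powr (2*\<alpha> + \<gamma>) / \<mu> n powr (2*m)))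
      = Re (z n) / \<mu> n powr t"
      using mu_pos tracks_nonreal_root[OF z d]
    proof eventually_elim
      case (elim n)
      let ?q = "(cmod (h n))\<^sup>2 + 2 * \<mu> n powr (2*\<alpha> + \<gamma>)"
      have "hs n = h n / of_real (\<mu> n powr m)"
        using elim by (simp add: hs_def h_def add_divide_distrib)
      then have "(cmod (hs n))\<^sup>2 = (cmod (h n))\<^sup>2 / \<mu> n powr (2*m)"
        using elim powr_powr[of "\<mu> n" m 2] by (simp add: norm_divide power_divide mult.commute)
      then have hs: "(cmod (hs n))\<^sup>2 + 2 * (\<mu> n powr (2*\<alpha> + \<gamma>) / \<mu> n powr (2*m)) = ?q / \<mu> n powr (2*m)"
        by (simp add: add_divide_distrib)
      have "?q > 0" using elim by (simp add: add_nonneg_pos)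
      have "Re (z n) * ((cmod (h n))\<^sup>2 + 2 * \<mu> n powr \<gamma> * \<mu> n powr (2*\<alpha>)) =
          - (\<mu> n powr \<gamma> * \<mu> n powr (2*\<alpha>) * \<mu> n powr \<beta>)"
        unfolding h_def using elim by (intro nonreal_root_Re) auto
      then have "Re (z n) * ?q = - (\<mu> n powr (2*\<alpha> + \<beta> + \<gamma>))"
        using elim by (simp add: powr_add mult_ac)
      then have "Re (z n) = - (\<mu> n powr (2*\<alpha> + \<beta> + \<gamma>)) / ?q"
        using \<open>?q > 0\<close> by (intro eq_divide_imp) simp_all
      then show ?case unfolding hs t using elim \<open>?q > 0\<close> by (simp add: powr_diff)
    qed
  qed
qed (use D in simp)

text \<open>K is the limit of k divided by \<open>\<mu> n powr m\<close>. As it is nonzero,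
  numerator and denominator of the second identity have the same order, and the real part has order
  \<beta>.\<close>

lemma Re_asymp_via_k:
  assumes z: "tracks z (Complex 0 d) s" and d: "d \<noteq> 0"
    and dom: "dominates m (2*s) b1" "dominates m \<gamma> b2" "dominates (2*m) (2*\<alpha> + \<gamma>) b3"
    and K: "K = 2 * of_bool b2 - d\<^sup>2 * of_bool b1" "K \<noteq> 0"
    and c: "c = - K\<^sup>2 / (2 * K\<^sup>2 + 4 * of_bool b3)"
  shows "(\<lambda>n. Re (z n)) \<sim>[sequentially] (\<lambda>n. c * \<mu> n powr \<beta>)"
proof (rule asymp_equivI'_const)
  have fol: "follows z (Complex 0 d) s" using z unfolding tracks_def by blast
  have K_pos: "2 * K\<^sup>2 + 4 * of_bool b3 > 0" using K(2) by (simp add: add_pos_nonneg)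
  show "c \<noteq> 0" using K_pos K(2) by (simp add: c)
  define k where "k n = (z n)\<^sup>2 + of_real (2 * \<mu> n powr \<gamma>)" for n
  define ks where "ks n = of_real (\<mu> n powr 0) * z n ^ 2 / of_real (\<mu> n powr m)
    + of_real (2 * (\<mu> n powr \<gamma> / \<mu> n powr m))" for n
  have "ks \<longlonglongrightarrow> Complex 0 d ^ 2 * of_real (of_bool b1) + of_real (2 * of_bool b2)"
    unfolding ks_def[abs_def]
    by (intro tendsto_add tendsto_of_real tendsto_mult tendsto_const follows_scaled[OF fol, where k = 2]
        dominates_scaled_tendsto) (use dom in simp_all)
  also have "Complex 0 d ^ 2 * of_real (of_bool b1) + of_real (2 * of_bool b2) = of_real K"
    by (simp add: K(1) complex_eq_iff power2_eq_square)
  finally have "(\<lambda>n. (cmod (ks n))\<^sup>2) \<longlonglongrightarrow> (cmod (of_real K))\<^sup>2"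
    by (intro tendsto_intros)
  then have ks_lim: "(\<lambda>n. (cmod (ks n))\<^sup>2) \<longlonglongrightarrow> K\<^sup>2" by simp
  have "(\<lambda>n. - (cmod (ks n))\<^sup>2 / (2 * (cmod (ks n))\<^sup>2 + 4 * (\<mu> n powr (2*\<alpha> + \<gamma>) / \<mu> n powr (2*m)))) \<longlonglongrightarrow> c"
    unfolding c using K_pos by (intro tendsto_intros ks_lim dominates_scaled_tendsto dom) simp
  then show "(\<lambda>n. Re (z n) / \<mu> n powr \<beta>) \<longlonglongrightarrow> c"
  proof (rule Lim_transform_eventually)
    show "\<forall>\<^sub>F n in sequentially. - (cmod (ks n))\<^sup>2 / (2 * (cmod (ks n))\<^sup>2 + 4 * (\<mu> n powr (2*\<alpha> + \<gamma>) / \<mu> n powr (2*m)))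
      = Re (z n) / \<mu> n powr \<beta>"
      using mu_pos tracks_nonreal_root[OF z d]
    proof eventually_elim
      case (elim n)
      let ?q = "2 * (cmod (k n))\<^sup>2 + 4 * \<mu> n powr (2*\<alpha> + \<gamma>)"
      have "ks n = k n / of_real (\<mu> n powr m)"
        using elim by (simp add: ks_def k_def add_divide_distrib)
      then have ks: "(cmod (ks n))\<^sup>2 = (cmod (k n))\<^sup>2 / \<mu> n powr (2*m)"
        using elim powr_powr[of "\<mu> n" m 2] by (simp add: norm_divide power_divide mult.commute)
      have den: "2 * (cmod (ks n))\<^sup>2 + 4 * (\<mu> n powr (2*\<alpha> + \<gamma>) / \<mu> n powr (2*m)) = ?q / \<mu> n powr (2*m)"
        by (simp add: ks add_divide_distrib)
      have "?q > 0" using elim by (simp add: add_nonneg_pos)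
      have "Re (z n) * (2 * (cmod (k n))\<^sup>2 + 4 * \<mu> n powr \<gamma> * \<mu> n powr (2*\<alpha>)) =
          - (\<mu> n powr \<beta> * (cmod (k n))\<^sup>2)"
        unfolding k_def using elim by (intro nonreal_root_Re) auto
      then have "Re (z n) * ?q = - (\<mu> n powr \<beta> * (cmod (k n))\<^sup>2)"
        using elim by (simp add: powr_add mult_ac)
      then have "Re (z n) = - (\<mu> n powr \<beta> * (cmod (k n))\<^sup>2) / ?q"
        using \<open>?q > 0\<close> by (intro eq_divide_imp) simp_all
      then show ?case unfolding den unfolding ks using elim \<open>?q > 0\<close> by simp
    qed
  qed
qed

text \<open>F now numbers the terms of h in order, with 5 for the product term
  \<open>2*\<alpha> + \<gamma>\<close>, compared with \<open>2*m\<close>. The equation for c avoids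
  division and also shows that its second factor is nonzero.\<close>

lemma sep_pair_via_h:
  fixes F :: "nat set"
  assumes br: "branch (Complex 0 d) s"
    and dom: "dominates m (2*s) (1 \<in> F)" "dominates m (\<beta> + s) (2 \<in> F)"
      "dominates m 1 (3 \<in> F)" "dominates m (2*\<alpha>) (4 \<in> F)"
      "dominates (2*m) (2*\<alpha> + \<gamma>) (5 \<in> F)"
    and c: "c * ((of_bool (3 \<in> F) + of_bool (4 \<in> F) - d\<^sup>2 * of_bool (1 \<in> F))\<^sup>2 + d\<^sup>2 * of_bool (2 \<in> F) + 2 * of_bool (5 \<in> F)) = - 1"
    and "t = 2*\<alpha> + \<beta> + \<gamma> - 2*m" "d \<noteq> 0"
  shows "root_pair (sep_pair c t d s) (Complex 0 d) s (Complex 0 (- d)) s"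
proof -
  let ?D = "(of_bool (3 \<in> F) + of_bool (4 \<in> F) - d\<^sup>2 * of_bool (1 \<in> F))\<^sup>2 + d\<^sup>2 * of_bool (2 \<in> F) + 2 * of_bool (5 \<in> F)"
  have D: "?D \<noteq> 0" using c by (intro notI) simp
  have c': "c = - 1 / ?D" using c D by (intro eq_divide_imp)
  \<comment> \<open>Only the square of the imaginary coefficient enters, so both conjugates are
    covered at once.\<close>
  have re: "(\<lambda>n. Re (z n)) \<sim>[sequentially] (\<lambda>n. c * \<mu> n powr t)" if "tracks z (Complex 0 e) s" "e\<^sup>2 = d\<^sup>2" for z e
    unfolding c' using that assms D by (intro Re_asymp_via_h[OF that(1)]) auto
  show ?thesis
    unfolding root_pair_def sep_pair_def
  proof (intro conjI allI impI br branch_cnj)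
    fix z w assume z: "tracks z (Complex 0 d) s" and w: "tracks w (Complex 0 (- d)) s"
    show "(\<lambda>n. Re (z n)) \<sim>[sequentially] (\<lambda>n. c * \<mu> n powr t)"
    "(\<lambda>n. Re (w n)) \<sim>[sequentially] (\<lambda>n. c * \<mu> n powr t)"
      using re[OF z] re[OF w] by simp_all
    show "(\<lambda>n. Im (z n)) \<sim>[sequentially] (\<lambda>n. d * \<mu> n powr s)"
    "(\<lambda>n. Im (w n)) \<sim>[sequentially] (\<lambda>n. - d * \<mu> n powr s)"
      using follows_Im[of z "Complex 0 d" s] follows_Im[of w "Complex 0 (- d)" s] z w \<open>d \<noteq> 0\<close>
      unfolding tracks_def by simp_all
  qed
qed

text \<open>In F, 1 and 2 are the terms of k, and 3 is the product term of exponent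
  \<open>2*\<alpha> + \<gamma>\<close>.\<close>

lemma sep_pair_via_k:
  fixes F :: "nat set"
  assumes br: "branch (Complex 0 d) s"
    and dom: "dominates m (2*s) (1 \<in> F)" "dominates m \<gamma> (2 \<in> F)" "dominates (2*m) (2*\<alpha> + \<gamma>) (3 \<in> F)"
    and "d\<^sup>2 * of_bool (1 \<in> F) \<noteq> 2 * of_bool (2 \<in> F)"
    and c: "c * (2 * (2 * of_bool (2 \<in> F) - d\<^sup>2 * of_bool (1 \<in> F))\<^sup>2 + 4 * of_bool (3 \<in> F))
      = - (2 * of_bool (2 \<in> F) - d\<^sup>2 * of_bool (1 \<in> F))\<^sup>2"
    and "t = \<beta>" "d \<noteq> 0"
  shows "root_pair (sep_pair c t d s) (Complex 0 d) s (Complex 0 (- d)) s"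
proof -
  let ?K = "2 * of_bool (2 \<in> F) - d\<^sup>2 * of_bool (1 \<in> F)"
  have K: "?K \<noteq> 0" using assms(5) by simp
  then have "2 * ?K\<^sup>2 + 4 * of_bool (3 \<in> F) > 0" by (simp add: add_pos_nonneg)
  then have c': "c = - ?K\<^sup>2 / (2 * ?K\<^sup>2 + 4 * of_bool (3 \<in> F))" using c by (intro eq_divide_imp) simp_all
  have re: "(\<lambda>n. Re (z n)) \<sim>[sequentially] (\<lambda>n. c * \<mu> n powr t)" if "tracks z (Complex 0 e) s" "e\<^sup>2 = d\<^sup>2" for z e
    unfolding \<open>t = \<beta>\<close> using that assms K c' by (intro Re_asymp_via_k[OF that(1)]) auto
  show ?thesis
    unfolding root_pair_def sep_pair_def
  proof (intro conjI allI impI br branch_cnj)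
    fix z w assume z: "tracks z (Complex 0 d) s" and w: "tracks w (Complex 0 (- d)) s"
    show "(\<lambda>n. Re (z n)) \<sim>[sequentially] (\<lambda>n. c * \<mu> n powr t)"
    "(\<lambda>n. Re (w n)) \<sim>[sequentially] (\<lambda>n. c * \<mu> n powr t)"
      using re[OF z] re[OF w] by simp_all
    show "(\<lambda>n. Im (z n)) \<sim>[sequentially] (\<lambda>n. d * \<mu> n powr s)"
    "(\<lambda>n. Im (w n)) \<sim>[sequentially] (\<lambda>n. - d * \<mu> n powr s)"
      using follows_Im[of z "Complex 0 d" s] follows_Im[of w "Complex 0 (- d)" s] z w \<open>d \<noteq> 0\<close>
      unfolding tracks_def by simp_all
  qed
qed

section \<open>The regions\<close>

text \<open>The first fact separates the coefficients \<open>sqrt 2\<close> and \<open>- 1\<close>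
  in \<open>F1\<close>, where all exponents agree; the second makes \<open>2 - sqrt 2\<close>
  nonnegative for \<open>L12\<close>.\<close>

lemma sqrt_2_bounds: "sqrt 2 \<noteq> - 1" "sqrt 2 \<le> 2"
  using real_sqrt_ge_zero[of 2] by (linarith, simp add: real_le_lsqrt)

lemma mult_sqrt_sqrt: "x \<ge> 0 \<Longrightarrow> a * sqrt x * sqrt x = a * x"
  by (simp add: mult.assoc)

lemmas evaluate = complex_eq_iff power2_eq_square power3_eq_cube power4_eq_xxxx sqrt_2_bounds

section \<open>Regions with \<gamma> at least 1\<close>

lemma roots_V1:
  assumes "(\<alpha>, \<beta>, \<gamma>) \<in> V1"
  shows "roots_asymp \<mu> r
    (sep_pair (-1/4) (2*\<alpha> + \<beta> - \<gamma>) (sqrt 2) (\<gamma>/2))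
    (sep_pair (-1/2) \<beta> 1 (1/2))"
proof -
  note region = assms[unfolded V1_def E_def, simplified]
  have b1: "branch (Complex 0 (sqrt 2)) (\<gamma>/2)"
    by (rule branchI[where m = "2*\<gamma>" and F = "{1,5}"])
      (use region in \<open>simp_all add: evaluate\<close>)
  have b2: "branch (Complex 0 1) (1/2)"
    by (rule branchI[where m = "1 + \<gamma>" and F = "{5,7}"])
      (use region in \<open>simp_all add: evaluate\<close>)
  show ?thesis
    \<comment> \<open>On the first pair the two terms of k cancel; on the second the terms
      \<open>\<lambda>^2\<close> and \<mu> of h cancel, while k is of order \<gamma>.\<close>
    by (rule roots_asympI[OF sep_pair_via_h[OF b1, where m = "\<gamma>" and F = "{1}"]
        sep_pair_via_k[OF b2, where m = "\<gamma>" and F = "{2}"]])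
      (use region in \<open>simp_all add: evaluate\<close>)
qed

text \<open>On the second pair neither factor cancels: k is about
  \<open>2 * \<mu> powr \<gamma>\<close> and h about \<open>\<mu> powr (2*\<alpha>)\<close>. The
  square of h exceeds the product term because \<alpha> > \<gamma>/2.\<close>

lemma roots_V2:
  assumes "(\<alpha>, \<beta>, \<gamma>) \<in> V2"
  shows "roots_asymp \<mu> r
    (sep_pair (-1/2) \<beta> 1 \<alpha>)
    (sep_pair (-1) (-2*\<alpha> + \<beta> + \<gamma>) (sqrt 2) (-\<alpha> + \<gamma>/2 + 1/2))"
proof -
  note region = assms[unfolded V2_def E_def, simplified]
  have b1: "branch (Complex 0 1) \<alpha>"
    by (rule branchI[where m = "4*\<alpha>" and F = "{1,4}"])
      (use region in \<open>simp_all add: evaluate\<close>)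
  have b2: "branch (Complex 0 (sqrt 2)) (-\<alpha> + \<gamma>/2 + 1/2)"
    by (rule branchI[where m = "1 + \<gamma>" and F = "{4,7}"])
      (use region in \<open>simp_all add: evaluate\<close>)
  show ?thesis
    by (rule roots_asympI[OF sep_pair_via_k[OF b1, where m = "2*\<alpha>" and F = "{1}"]
        sep_pair_via_h[OF b2, where m = "2*\<alpha>" and F = "{4}"]])
      (use region in \<open>simp_all add: evaluate\<close>)
qed

text \<open>For \<beta> > 1/2 the factor
  \<open>\<lambda>^2 + \<mu>^\<beta> \<lambda> + \<mu>\<close> behind the second pair of
  \<open>V1\<close> is overdamped, and its roots come from separate balances.\<close>

lemma roots_V3:
  assumes "(\<alpha>, \<beta>, \<gamma>) \<in> V3"
  shows "roots_asymp \<mu> r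
    (sep_pair (-1/4) (2*\<alpha> + \<beta> - \<gamma>) (sqrt 2) (\<gamma>/2))
    (real_pair (-1) (1 - \<beta>) (-1) \<beta>)"
proof -
  note region = assms[unfolded V3_def E_def, simplified]
  have b1: "branch (Complex 0 (sqrt 2)) (\<gamma>/2)"
    by (rule branchI[where m = "2*\<gamma>" and F = "{1,5}"])
      (use region in \<open>simp_all add: evaluate\<close>)
  have b2: "branch (of_real (-1)) (1 - \<beta>)"
    by (rule branchI[where m = "1 + \<gamma>" and F = "{6,7}"])
      (use region in \<open>simp_all add: evaluate\<close>)
  have b3: "branch (of_real (-1)) \<beta>"
    by (rule branchI[where m = "2*\<beta> + \<gamma>" and F = "{5,6}"])
      (use region in \<open>simp_all add: evaluate\<close>)
  show ?thesis
    by (rule roots_asympI[OF sep_pair_via_h[OF b1, where m = "\<gamma>" and F = "{1}"]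
        real_pairI[OF b2 b3]])
      (use region in \<open>simp_all add: evaluate\<close>)
qed

text \<open>The terms 4, 6, 7 form a quadratic whose discriminant turns positive to leading order
  exactly when \<open>2*\<alpha> - 2*\<beta> - \<gamma> + 1 < 0\<close>; this splits the second pair
  of \<open>V2\<close>.\<close>

lemma roots_V4:
  assumes "(\<alpha>, \<beta>, \<gamma>) \<in> V4"
  shows "roots_asymp \<mu> r
    (sep_pair (-1/2) \<beta> 1 \<alpha>)
    (real_pair (-1) (1 - \<beta>) (-2) (-2*\<alpha> + \<beta> + \<gamma>))"
proof -
  note region = assms[unfolded V4_def E_def, simplified]
  have b1: "branch (Complex 0 1) \<alpha>"
    by (rule branchI[where m = "4*\<alpha>" and F = "{1,4}"])
      (use region in \<open>simp_all add: evaluate\<close>)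
  have b2: "branch (of_real (-1)) (1 - \<beta>)"
    by (rule branchI[where m = "1 + \<gamma>" and F = "{6,7}"])
      (use region in \<open>simp_all add: evaluate\<close>)
  have b3: "branch (of_real (-2)) (-2*\<alpha> + \<beta> + \<gamma>)"
    by (rule branchI[where m = "-2*\<alpha> + 2*\<beta> + 2*\<gamma>" and F = "{4,6}"])
      (use region in \<open>simp_all add: evaluate\<close>)
  show ?thesis
    by (rule roots_asympI[OF sep_pair_via_k[OF b1, where m = "2*\<alpha>" and F = "{1}"]
        real_pairI[OF b2 b3]])
      (use region in \<open>simp_all add: evaluate\<close>)
qed

text \<open>The oscillating pair comes from
  \<open>\<mu>^\<beta> \<lambda> (\<lambda>^2 + 2 \<mu>^\<gamma>)\<close>; there
  \<open>\<mu>^\<beta> \<lambda>\<close> dominates h, so D is 2.\<close>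

lemma roots_V5:
  assumes "(\<alpha>, \<beta>, \<gamma>) \<in> V5"
  shows "roots_asymp \<mu> r
    (real_pair (-1) (1 - \<beta>) (-1) \<beta>)
    (sep_pair (-1/2) (2*\<alpha> - \<beta>) (sqrt 2) (\<gamma>/2))"
proof -
  note region = assms[unfolded V5_def E_def, simplified]
  have b1: "branch (of_real (-1)) (1 - \<beta>)"
    by (rule branchI[where m = "1 + \<gamma>" and F = "{6,7}"])
      (use region in \<open>simp_all add: evaluate\<close>)
  have b2: "branch (of_real (-1)) \<beta>"
    by (rule branchI[where m = "4*\<beta>" and F = "{1,2}"])
      (use region in \<open>simp_all add: evaluate\<close>)
  have b3: "branch (Complex 0 (sqrt 2)) (\<gamma>/2)"
    by (rule branchI[where m = "\<beta> + 3*\<gamma>/2" and F = "{2,6}"])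
      (use region in \<open>simp_all add: evaluate\<close>)
  show ?thesis
    by (rule roots_asympI[OF real_pairI[OF b1 b2]
        sep_pair_via_h[OF b3, where m = "\<beta> + \<gamma>/2" and F = "{2}"]])
      (use region in \<open>simp_all add: evaluate\<close>)
qed

text \<open>The terms 1, 2, 4, 6, 7 balance consecutively. Neighbours differ by one power of
  \<lambda>, so each balance gives one real root.\<close>

lemma roots_V6:
  assumes "(\<alpha>, \<beta>, \<gamma>) \<in> V6"
  shows "roots_asymp \<mu> r
    (real_pair (-1) (2*\<alpha> - \<beta>) (-1) \<beta>)
    (real_pair (-2) (-2*\<alpha> + \<beta> + \<gamma>) (-1) (1 - \<beta>))"
proof -
  note region = assms[unfolded V6_def E_def, simplified]
  have b1: "branch (of_real (-1)) (2*\<alpha> - \<beta>)"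
    by (rule branchI[where m = "6*\<alpha> - 2*\<beta>" and F = "{2,4}"])
      (use region in \<open>simp_all add: evaluate\<close>)
  have b2: "branch (of_real (-1)) \<beta>"
    by (rule branchI[where m = "4*\<beta>" and F = "{1,2}"])
      (use region in \<open>simp_all add: evaluate\<close>)
  have b3: "branch (of_real (-2)) (-2*\<alpha> + \<beta> + \<gamma>)"
    by (rule branchI[where m = "-2*\<alpha> + 2*\<beta> + 2*\<gamma>" and F = "{4,6}"])
      (use region in \<open>simp_all add: evaluate\<close>)
  have b4: "branch (of_real (-1)) (1 - \<beta>)"
    by (rule branchI[where m = "1 + \<gamma>" and F = "{6,7}"])
      (use region in \<open>simp_all add: evaluate\<close>)
  show ?thesis
    by (rule roots_asympI[OF real_pairI[OF b1 b2]
        real_pairI[OF b3 b4]])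
      (use region in \<open>simp_all add: evaluate\<close>)
qed

text \<open>With 2\<alpha> = \<gamma> the terms 4 and 5 add up to
  \<open>3 \<mu>^\<gamma> \<lambda>^2\<close>, and the product term enters the denominators. K is -1
  on the first pair and 2 on the second.\<close>

lemma roots_F12:
  assumes "(\<alpha>, \<beta>, \<gamma>) \<in> F12"
  shows "roots_asymp \<mu> r
    (sep_pair (-1/6) \<beta> (sqrt 3) (\<gamma>/2))
    (sep_pair (-1/3) \<beta> (sqrt 6 / 3) (1/2))"
proof -
  note region = assms[unfolded F12_def E_def, simplified]
  have b1: "branch (Complex 0 (sqrt 3)) (\<gamma>/2)"
    by (rule branchI[where m = "2*\<gamma>" and F = "{1,4,5}"])
      (use region in \<open>simp_all add: evaluate\<close>)
  have b2: "branch (Complex 0 (sqrt 6 / 3)) (1/2)"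
    by (rule branchI[where m = "1 + \<gamma>" and F = "{4,5,7}"])
      (use region in \<open>simp_all add: evaluate\<close>)
  show ?thesis
    by (rule roots_asympI[OF sep_pair_via_k[OF b1, where m = "\<gamma>" and F = "{1,2,3}"]
        sep_pair_via_k[OF b2, where m = "\<gamma>" and F = "{2,3}"]])
      (use region in \<open>simp_all add: evaluate\<close>)
qed

lemma roots_F13:
  assumes "(\<alpha>, \<beta>, \<gamma>) \<in> F13"
  shows "roots_asymp \<mu> r
    (sep_pair (-1/4) (2*\<alpha> + \<beta> - \<gamma>) (sqrt 2) (\<gamma>/2))
    (sep_pair (-1/2) \<beta> (sqrt 3 / 2) (1/2))"
proof -
  note region = assms[unfolded F13_def E_def, simplified]
  have b1: "branch (Complex 0 (sqrt 2)) (\<gamma>/2)"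
    by (rule branchI[where m = "2*\<gamma>" and F = "{1,5}"])
      (use region in \<open>simp_all add: evaluate\<close>)
  have b2: "branch (Complex (-1/2) (sqrt 3 / 2)) (1/2)"
    by (rule branchI[where m = "1 + \<gamma>" and F = "{5,6,7}"])
      (use region in \<open>simp_all add: evaluate\<close>)
  show ?thesis
    by (rule roots_asympI[OF sep_pair_via_h[OF b1, where m = "\<gamma>" and F = "{1}"]
        sep_pairI[OF b2]])
      (use region in \<open>simp_all add: evaluate\<close>)
qed

lemma roots_F24:
  assumes "(\<alpha>, \<beta>, \<gamma>) \<in> F24"
  shows "roots_asymp \<mu> r
    (sep_pair (-1/2) \<beta> 1 \<alpha>)
    (cplx_pair (-1) 1 (1 - \<beta>))"
proof -
  note region = assms[unfolded F24_def E_def, simplified]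
  have b1: "branch (Complex 0 1) \<alpha>"
    by (rule branchI[where m = "4*\<alpha>" and F = "{1,4}"])
      (use region in \<open>simp_all add: evaluate\<close>)
  \<comment> \<open>A root of \<open>c^2 + 2 c + 2\<close>.\<close>
  have b2: "branch (Complex (-1) 1) (1 - \<beta>)"
    by (rule branchI[where m = "1 + \<gamma>" and F = "{4,6,7}"])
      (use region in \<open>simp_all add: evaluate\<close>)
  show ?thesis
    by (rule roots_asympI[OF sep_pair_via_k[OF b1, where m = "2*\<alpha>" and F = "{1}"]
        cplx_pairI[OF b2]])
      (use region in \<open>simp_all add: evaluate\<close>)
qed

lemma roots_F34:
  assumes "(\<alpha>, \<beta>, \<gamma>) \<in> F34"
  shows "roots_asymp \<mu> r
    (sep_pair (-1/6) \<beta> (sqrt 3) (\<gamma>/2))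
    (real_pair (-1) (1 - \<beta>) (-2/3) \<beta>)"
proof -
  note region = assms[unfolded F34_def E_def, simplified]
  have b1: "branch (Complex 0 (sqrt 3)) (\<gamma>/2)"
    by (rule branchI[where m = "2*\<gamma>" and F = "{1,4,5}"])
      (use region in \<open>simp_all add: evaluate\<close>)
  have b2: "branch (of_real (-1)) (1 - \<beta>)"
    by (rule branchI[where m = "1 + \<gamma>" and F = "{6,7}"])
      (use region in \<open>simp_all add: evaluate\<close>)
  have b3: "branch (of_real (-2/3)) \<beta>"
    by (rule branchI[where m = "2*\<beta> + \<gamma>" and F = "{4,5,6}"])
      (use region in \<open>simp_all add: evaluate\<close>)
  show ?thesis
    by (rule roots_asympI[OF sep_pair_via_k[OF b1, where m = "\<gamma>" and F = "{1,2,3}"]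
        real_pairI[OF b2 b3]])
      (use region in \<open>simp_all add: evaluate\<close>)
qed

text \<open>The balance \<open>{1,2,5,6}\<close> has the polynomial
  \<open>c (c + 1) (c^2 + 2)\<close>, which serves both the root -1 and the pair. There D is 4 +
  2.\<close>

lemma roots_F35:
  assumes "(\<alpha>, \<beta>, \<gamma>) \<in> F35"
  shows "roots_asymp \<mu> r
    (real_pair (-1) (1 - \<beta>) (-1) \<beta>)
    (sep_pair (-1/6) (2*\<alpha> - \<beta>) (sqrt 2) (\<gamma>/2))"
proof -
  note region = assms[unfolded F35_def E_def, simplified]
  have b1: "branch (of_real (-1)) (1 - \<beta>)"
    by (rule branchI[where m = "1 + \<gamma>" and F = "{6,7}"])
      (use region in \<open>simp_all add: evaluate\<close>)
  have b2: "branch (of_real (-1)) \<beta>"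
    by (rule branchI[where m = "4*\<beta>" and F = "{1,2,5,6}"])
      (use region in \<open>simp_all add: evaluate\<close>)
  have b3: "branch (Complex 0 (sqrt 2)) (\<gamma>/2)"
    by (rule branchI[where m = "2*\<gamma>" and F = "{1,2,5,6}"])
      (use region in \<open>simp_all add: evaluate\<close>)
  show ?thesis
    by (rule roots_asympI[OF real_pairI[OF b1 b2]
        sep_pair_via_h[OF b3, where m = "\<gamma>" and F = "{1,2}"]])
      (use region in \<open>simp_all add: evaluate\<close>)
qed

lemma roots_L1234:
  assumes "(\<alpha>, \<beta>, \<gamma>) \<in> L1234"
  shows "roots_asymp \<mu> r
    (sep_pair (-1/6) (1/2) (sqrt 3) (\<gamma>/2))
    (cplx_pair (-1/3) (sqrt 5 / 3) (1/2))"
proof -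
  note region = assms[unfolded L1234_def E_def, simplified]
  have b1: "branch (Complex 0 (sqrt 3)) (\<gamma>/2)"
    by (rule branchI[where m = "2*\<gamma>" and F = "{1,4,5}"])
      (use region in \<open>simp_all add: evaluate\<close>)
  \<comment> \<open>A root of \<open>3 c^2 + 2 c + 2\<close>.\<close>
  have b2: "branch (Complex (-1/3) (sqrt 5 / 3)) (1/2)"
    by (rule branchI[where m = "1 + \<gamma>" and F = "{4,5,6,7}"])
      (use region in \<open>simp_all add: evaluate\<close>)
  show ?thesis
    by (rule roots_asympI[OF sep_pair_via_k[OF b1, where m = "\<gamma>" and F = "{1,2,3}"]
        cplx_pairI[OF b2]])
      (use region in \<open>simp_all add: evaluate\<close>)
qed

text \<open>All four roots have order 1/2, with leading polynomial
  \<open>(c^2 + 1) (c^2 + 2)\<close>.\<close>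

lemma roots_F1:
  assumes "(\<alpha>, \<beta>, \<gamma>) \<in> F1"
  shows "roots_asymp \<mu> r
    (sep_pair (-1) (2*\<alpha> + \<beta> - 1) (sqrt 2) (1/2))
    (sep_pair (-1/2) \<beta> 1 (1/2))"
proof -
  note region = assms[unfolded F1_def E_def, simplified]
  have b1: "branch (Complex 0 (sqrt 2)) (1/2)"
    by (rule branchI[where m = "2" and F = "{1,3,5,7}"])
      (use region in \<open>simp_all add: evaluate\<close>)
  have b2: "branch (Complex 0 1) (1/2)"
    by (rule branchI[where m = "2" and F = "{1,3,5,7}"])
      (use region in \<open>simp_all add: evaluate\<close>)
  show ?thesis
    by (rule roots_asympI[OF sep_pair_via_h[OF b1, where m = "1" and F = "{1,3}"]
        sep_pair_via_k[OF b2, where m = "1" and F = "{1,2}"]])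
      (use region in \<open>simp_all add: evaluate\<close>)
qed

text \<open>The leading polynomial \<open>c^4 + 4 c^2 + 2\<close> has
  \<open>c^2 = - 2 - sqrt 2\<close> or \<open>c^2 = - 2 + sqrt 2\<close>. In both cases
  \<open>K^2 = 2\<close>, hence the common real part.\<close>

lemma roots_L12:
  assumes "(\<alpha>, \<beta>, \<gamma>) \<in> L12"
  shows "roots_asymp \<mu> r
    (sep_pair (-1/4) \<beta> (sqrt (2 + sqrt 2)) (1/2))
    (sep_pair (-1/4) \<beta> (sqrt (2 - sqrt 2)) (1/2))"
proof -
  note region = assms[unfolded L12_def E_def, simplified]
  have b1: "branch (Complex 0 (sqrt (2 + sqrt 2))) (1/2)"
    by (rule branchI[where m = "2" and F = "{1,3,4,5,7}"])
      (use region in \<open>simp_all add: evaluate mult_sqrt_sqrt algebra_simps\<close>,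
       use real_sqrt_gt_zero[of 2] in linarith)
  have b2: "branch (Complex 0 (sqrt (2 - sqrt 2))) (1/2)"
    by (rule branchI[where m = "2" and F = "{1,3,4,5,7}"])
      (use region in \<open>simp_all add: evaluate mult_sqrt_sqrt algebra_simps\<close>)
  \<comment> \<open>All exponents are 1/2, so the four branches are told apart by their coefficients
    alone.\<close>
  have pos: "sqrt 2 > 0" "sqrt 2 < 2" by (simp_all add: real_less_lsqrt)
  then have "sqrt (2 + sqrt 2) > 0" "sqrt (2 - sqrt 2) > 0" by (simp_all add: add_pos_pos)
  with pos have distinct_roots: "2 + sqrt 2 \<noteq> 0" "sqrt 2 \<noteq> 2"
    "sqrt (2 + sqrt 2) \<noteq> - sqrt (2 - sqrt 2)" "- sqrt (2 + sqrt 2) \<noteq> sqrt (2 - sqrt 2)"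
    by linarith+
  show ?thesis
    by (rule roots_asympI[OF sep_pair_via_k[OF b1, where m = "1" and F = "{1,2,3}"]
        sep_pair_via_k[OF b2, where m = "1" and F = "{1,2,3}"]])
      (use region in \<open>simp_all add: evaluate distinct_roots\<close>)
qed

text \<open>The leading polynomial is \<open>(c^2 + 2) (c^2 + c + 1)\<close>.\<close>

lemma roots_L15:
  assumes "(\<alpha>, \<beta>, \<gamma>) \<in> L15"
  shows "roots_asymp \<mu> r
    (sep_pair (-1/3) (2*\<alpha> - 1/2) (sqrt 2) (1/2))
    (sep_pair (-1/2) (1/2) (sqrt 3 / 2) (1/2))"
proof -
  note region = assms[unfolded L15_def E_def, simplified]
  have b1: "branch (Complex 0 (sqrt 2)) (1/2)"
    by (rule branchI[where m = "2" and F = "{1,2,3,5,6,7}"])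
      (use region in \<open>simp_all add: evaluate\<close>)
  have b2: "branch (Complex (-1/2) (sqrt 3 / 2)) (1/2)"
    by (rule branchI[where m = "2" and F = "{1,2,3,5,6,7}"])
      (use region in \<open>simp_all add: evaluate\<close>)
  show ?thesis
    by (rule roots_asympI[OF sep_pair_via_h[OF b1, where m = "1" and F = "{1,2,3}"]
        sep_pairI[OF b2]])
      (use region in \<open>simp_all add: evaluate\<close>)
qed

lemma roots_L26:
  assumes "(\<alpha>, \<beta>, \<gamma>) \<in> L26"
  shows "roots_asymp \<mu> r
    (sep_pair (-1/2) \<beta> (sqrt 3 / 2) \<alpha>)
    (cplx_pair (-1) 1 (1 - \<beta>))"
proof -
  note region = assms[unfolded L26_def E_def, simplified]
  have b1: "branch (Complex (-1/2) (sqrt 3 / 2)) \<alpha>"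
    by (rule branchI[where m = "4*\<alpha>" and F = "{1,2,4}"])
      (use region in \<open>simp_all add: evaluate\<close>)
  have b2: "branch (Complex (-1) 1) (1 - \<beta>)"
    by (rule branchI[where m = "2" and F = "{4,6,7}"])
      (use region in \<open>simp_all add: evaluate\<close>)
  show ?thesis
    by (rule roots_asympI[OF sep_pairI[OF b1]
        cplx_pairI[OF b2]])
      (use region in \<open>simp_all add: evaluate\<close>)
qed

section \<open>Regions with \<gamma> below 1\<close>

lemma roots_V1_bar:
  assumes "(\<alpha>, \<beta>, \<gamma>) \<in> V1_bar"
  shows "roots_asymp \<mu> r
    (sep_pair (-1/2) \<beta> 1 (1/2))
    (sep_pair (-1) (2*\<alpha> + \<beta> + \<gamma> - 2) (sqrt 2) (\<gamma>/2))"
proof -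
  note region = assms[unfolded V1_bar_def E_def, simplified]
  have b1: "branch (Complex 0 1) (1/2)"
    by (rule branchI[where m = "2" and F = "{1,3}"])
      (use region in \<open>simp_all add: evaluate\<close>)
  have b2: "branch (Complex 0 (sqrt 2)) (\<gamma>/2)"
    by (rule branchI[where m = "1 + \<gamma>" and F = "{3,7}"])
      (use region in \<open>simp_all add: evaluate\<close>)
  show ?thesis
    \<comment> \<open>Now 1/2 is the larger order: there \<open>\<lambda>^2\<close> dominates k,
      while on the pair of order \<gamma>/2 the terms of k cancel and h is about \<mu>.\<close>
    by (rule roots_asympI[OF sep_pair_via_k[OF b1, where m = "1" and F = "{1}"]
        sep_pair_via_h[OF b2, where m = "1" and F = "{3}"]])
      (use region in \<open>simp_all add: evaluate\<close>)
qed

lemma roots_V2_bar: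
  assumes "(\<alpha>, \<beta>, \<gamma>) \<in> V2_bar"
  shows "roots_asymp \<mu> r
    (sep_pair (-1/2) \<beta> 1 \<alpha>)
    (sep_pair (-1) (-2*\<alpha> + \<beta> + \<gamma>) (sqrt 2) (-\<alpha> + \<gamma>/2 + 1/2))"
proof -
  note region = assms[unfolded V2_bar_def E_def, simplified]
  have b1: "branch (Complex 0 1) \<alpha>"
    by (rule branchI[where m = "4*\<alpha>" and F = "{1,4}"])
      (use region in \<open>simp_all add: evaluate\<close>)
  have b2: "branch (Complex 0 (sqrt 2)) (-\<alpha> + \<gamma>/2 + 1/2)"
    by (rule branchI[where m = "1 + \<gamma>" and F = "{4,7}"])
      (use region in \<open>simp_all add: evaluate\<close>)
  show ?thesis
    by (rule roots_asympI[OF sep_pair_via_k[OF b1, where m = "2*\<alpha>" and F = "{1}"]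
        sep_pair_via_h[OF b2, where m = "2*\<alpha>" and F = "{4}"]])
      (use region in \<open>simp_all add: evaluate\<close>)
qed

lemma roots_V3_bar:
  assumes "(\<alpha>, \<beta>, \<gamma>) \<in> V3_bar"
  shows "roots_asymp \<mu> r
    (real_pair (-1) (1 - \<beta>) (-1) \<beta>)
    (sep_pair (-1) (2*\<alpha> + \<beta> + \<gamma> - 2) (sqrt 2) (\<gamma>/2))"
proof -
  note region = assms[unfolded V3_bar_def E_def, simplified]
  have b1: "branch (of_real (-1)) (1 - \<beta>)"
    by (rule branchI[where m = "3 - 2*\<beta>" and F = "{2,3}"])
      (use region in \<open>simp_all add: evaluate\<close>)
  have b2: "branch (of_real (-1)) \<beta>"
    by (rule branchI[where m = "4*\<beta>" and F = "{1,2}"])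
      (use region in \<open>simp_all add: evaluate\<close>)
  have b3: "branch (Complex 0 (sqrt 2)) (\<gamma>/2)"
    by (rule branchI[where m = "1 + \<gamma>" and F = "{3,7}"])
      (use region in \<open>simp_all add: evaluate\<close>)
  show ?thesis
    by (rule roots_asympI[OF real_pairI[OF b1 b2]
        sep_pair_via_h[OF b3, where m = "1" and F = "{3}"]])
      (use region in \<open>simp_all add: evaluate\<close>)
qed

text \<open>For \<beta> > \<alpha> the factor
  \<open>\<lambda>^2 + \<mu>^\<beta> \<lambda> + \<mu>^(2\<alpha>)\<close> of \<open>V2_bar\<close>
  is overdamped.\<close>

lemma roots_V4_bar:
  assumes "(\<alpha>, \<beta>, \<gamma>) \<in> V4_bar"
  shows "roots_asymp \<mu> r
    (real_pair (-1) (2*\<alpha> - \<beta>) (-1) \<beta>)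
    (sep_pair (-1) (-2*\<alpha> + \<beta> + \<gamma>) (sqrt 2) (-\<alpha> + \<gamma>/2 + 1/2))"
proof -
  note region = assms[unfolded V4_bar_def E_def, simplified]
  have b1: "branch (of_real (-1)) (2*\<alpha> - \<beta>)"
    by (rule branchI[where m = "6*\<alpha> - 2*\<beta>" and F = "{2,4}"])
      (use region in \<open>simp_all add: evaluate\<close>)
  have b2: "branch (of_real (-1)) \<beta>"
    by (rule branchI[where m = "4*\<beta>" and F = "{1,2}"])
      (use region in \<open>simp_all add: evaluate\<close>)
  have b3: "branch (Complex 0 (sqrt 2)) (-\<alpha> + \<gamma>/2 + 1/2)"
    by (rule branchI[where m = "1 + \<gamma>" and F = "{4,7}"])
      (use region in \<open>simp_all add: evaluate\<close>)
  show ?thesis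
    by (rule roots_asympI[OF real_pairI[OF b1 b2]
        sep_pair_via_h[OF b3, where m = "2*\<alpha>" and F = "{4}"]])
      (use region in \<open>simp_all add: evaluate\<close>)
qed

text \<open>The balances are those of \<open>V5\<close>; \<beta> > 1 - \<gamma>/2 makes
  \<open>\<mu>^\<beta> \<lambda>\<close> exceed \<mu> in h at order \<gamma>/2.\<close>

lemma roots_V5_bar:
  assumes "(\<alpha>, \<beta>, \<gamma>) \<in> V5_bar"
  shows "roots_asymp \<mu> r
    (real_pair (-1) (1 - \<beta>) (-1) \<beta>)
    (sep_pair (-1/2) (2*\<alpha> - \<beta>) (sqrt 2) (\<gamma>/2))"
proof -
  note region = assms[unfolded V5_bar_def E_def, simplified]
  have b1: "branch (of_real (-1)) (1 - \<beta>)"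
    by (rule branchI[where m = "1 + \<gamma>" and F = "{6,7}"])
      (use region in \<open>simp_all add: evaluate\<close>)
  have b2: "branch (of_real (-1)) \<beta>"
    by (rule branchI[where m = "4*\<beta>" and F = "{1,2}"])
      (use region in \<open>simp_all add: evaluate\<close>)
  have b3: "branch (Complex 0 (sqrt 2)) (\<gamma>/2)"
    by (rule branchI[where m = "\<beta> + 3*\<gamma>/2" and F = "{2,6}"])
      (use region in \<open>simp_all add: evaluate\<close>)
  show ?thesis
    by (rule roots_asympI[OF real_pairI[OF b1 b2]
        sep_pair_via_h[OF b3, where m = "\<beta> + \<gamma>/2" and F = "{2}"]])
      (use region in \<open>simp_all add: evaluate\<close>)
qed

text \<open>With 2\<alpha> = 1 the terms 3 and 4 add up to \<open>2 \<mu> \<lambda>^2\<close>. On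
  the second pair h is about \<open>2 \<mu>\<close>, so D is 4.\<close>

lemma roots_F12_bar:
  assumes "(\<alpha>, \<beta>, \<gamma>) \<in> F12_bar"
  shows "roots_asymp \<mu> r
    (sep_pair (-1/2) \<beta> (sqrt 2) (1/2))
    (sep_pair (-1/4) (\<beta> + \<gamma> - 1) 1 (\<gamma>/2))"
proof -
  note region = assms[unfolded F12_bar_def E_def, simplified]
  have b1: "branch (Complex 0 (sqrt 2)) (1/2)"
    by (rule branchI[where m = "2" and F = "{1,3,4}"])
      (use region in \<open>simp_all add: evaluate\<close>)
  have b2: "branch (Complex 0 1) (\<gamma>/2)"
    by (rule branchI[where m = "1 + \<gamma>" and F = "{3,4,7}"])
      (use region in \<open>simp_all add: evaluate\<close>)
  show ?thesis
    by (rule roots_asympI[OF sep_pair_via_k[OF b1, where m = "1" and F = "{1}"]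
        sep_pair_via_h[OF b2, where m = "1" and F = "{3,4}"]])
      (use region in \<open>simp_all add: evaluate\<close>)
qed

lemma roots_F13_bar:
  assumes "(\<alpha>, \<beta>, \<gamma>) \<in> F13_bar"
  shows "roots_asymp \<mu> r
    (sep_pair (-1/2) (1/2) (sqrt 3 / 2) (1/2))
    (sep_pair (-1) (2*\<alpha> + \<gamma> - 3/2) (sqrt 2) (\<gamma>/2))"
proof -
  note region = assms[unfolded F13_bar_def E_def, simplified]
  have b1: "branch (Complex (-1/2) (sqrt 3 / 2)) (1/2)"
    by (rule branchI[where m = "2" and F = "{1,2,3}"])
      (use region in \<open>simp_all add: evaluate\<close>)
  have b2: "branch (Complex 0 (sqrt 2)) (\<gamma>/2)"
    by (rule branchI[where m = "1 + \<gamma>" and F = "{3,7}"])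
      (use region in \<open>simp_all add: evaluate\<close>)
  show ?thesis
    by (rule roots_asympI[OF sep_pairI[OF b1]
        sep_pair_via_h[OF b2, where m = "1" and F = "{3}"]])
      (use region in \<open>simp_all add: evaluate\<close>)
qed

lemma roots_F24_bar:
  assumes "(\<alpha>, \<beta>, \<gamma>) \<in> F24_bar"
  shows "roots_asymp \<mu> r
    (sep_pair (-1/2) \<alpha> (sqrt 3 / 2) \<alpha>)
    (sep_pair (-1) (\<gamma> - \<alpha>) (sqrt 2) (-\<alpha> + \<gamma>/2 + 1/2))"
proof -
  note region = assms[unfolded F24_bar_def E_def, simplified]
  have b1: "branch (Complex (-1/2) (sqrt 3 / 2)) \<alpha>"
    by (rule branchI[where m = "4*\<alpha>" and F = "{1,2,4}"])
      (use region in \<open>simp_all add: evaluate\<close>)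
  have b2: "branch (Complex 0 (sqrt 2)) (-\<alpha> + \<gamma>/2 + 1/2)"
    by (rule branchI[where m = "1 + \<gamma>" and F = "{4,7}"])
      (use region in \<open>simp_all add: evaluate\<close>)
  show ?thesis
    by (rule roots_asympI[OF sep_pairI[OF b1]
        sep_pair_via_h[OF b2, where m = "2*\<alpha>" and F = "{4}"]])
      (use region in \<open>simp_all add: evaluate\<close>)
qed

lemma roots_F34_bar:
  assumes "(\<alpha>, \<beta>, \<gamma>) \<in> F34_bar"
  shows "roots_asymp \<mu> r
    (real_pair (-2) (1 - \<beta>) (-1) \<beta>)
    (sep_pair (-1/4) (\<beta> + \<gamma> - 1) 1 (\<gamma>/2))"
proof -
  note region = assms[unfolded F34_bar_def E_def, simplified]
  have b1: "branch (of_real (-2)) (1 - \<beta>)"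
    by (rule branchI[where m = "3 - 2*\<beta>" and F = "{2,3,4}"])
      (use region in \<open>simp_all add: evaluate\<close>)
  have b2: "branch (of_real (-1)) \<beta>"
    by (rule branchI[where m = "4*\<beta>" and F = "{1,2}"])
      (use region in \<open>simp_all add: evaluate\<close>)
  have b3: "branch (Complex 0 1) (\<gamma>/2)"
    by (rule branchI[where m = "1 + \<gamma>" and F = "{3,4,7}"])
      (use region in \<open>simp_all add: evaluate\<close>)
  show ?thesis
    by (rule roots_asympI[OF real_pairI[OF b1 b2]
        sep_pair_via_h[OF b3, where m = "1" and F = "{3,4}"]])
      (use region in \<open>simp_all add: evaluate\<close>)
qed

text \<open>The balance \<open>{2,3,6,7}\<close> has the polynomial
  \<open>(c + 1) (c^2 + 2)\<close>, and D is 1 + 2 on its pair.\<close>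

lemma roots_F35_bar:
  assumes "(\<alpha>, \<beta>, \<gamma>) \<in> F35_bar"
  shows "roots_asymp \<mu> r
    (real_pair (-1) (\<gamma>/2) (-1) (1 - \<gamma>/2))
    (sep_pair (-1/3) (2*\<alpha> + \<gamma>/2 - 1) (sqrt 2) (\<gamma>/2))"
proof -
  note region = assms[unfolded F35_bar_def E_def, simplified]
  have b1: "branch (of_real (-1)) (\<gamma>/2)"
    by (rule branchI[where m = "1 + \<gamma>" and F = "{2,3,6,7}"])
      (use region in \<open>simp_all add: evaluate\<close>)
  have b2: "branch (of_real (-1)) (1 - \<gamma>/2)"
    by (rule branchI[where m = "4 - 2*\<gamma>" and F = "{1,2}"])
      (use region in \<open>simp_all add: evaluate\<close>)
  have b3: "branch (Complex 0 (sqrt 2)) (\<gamma>/2)"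
    by (rule branchI[where m = "1 + \<gamma>" and F = "{2,3,6,7}"])
      (use region in \<open>simp_all add: evaluate\<close>)
  show ?thesis
    by (rule roots_asympI[OF real_pairI[OF b1 b2]
        sep_pair_via_h[OF b3, where m = "1" and F = "{2,3}"]])
      (use region in \<open>simp_all add: evaluate\<close>)
qed

lemma roots_L1234_bar:
  assumes "(\<alpha>, \<beta>, \<gamma>) \<in> L1234_bar"
  shows "roots_asymp \<mu> r
    (sep_pair (-1/2) (1/2) (sqrt 7 / 2) (1/2))
    (sep_pair (-1/4) (\<gamma> - 1/2) 1 (\<gamma>/2))"
proof -
  note region = assms[unfolded L1234_bar_def E_def, simplified]
  \<comment> \<open>A root of \<open>c^2 + c + 2\<close>.\<close>
  have b1: "branch (Complex (-1/2) (sqrt 7 / 2)) (1/2)"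
    by (rule branchI[where m = "2" and F = "{1,2,3,4}"])
      (use region in \<open>simp_all add: evaluate\<close>)
  have b2: "branch (Complex 0 1) (\<gamma>/2)"
    by (rule branchI[where m = "1 + \<gamma>" and F = "{3,4,7}"])
      (use region in \<open>simp_all add: evaluate\<close>)
  show ?thesis
    by (rule roots_asympI[OF sep_pairI[OF b1]
        sep_pair_via_h[OF b2, where m = "1" and F = "{3,4}"]])
      (use region in \<open>simp_all add: evaluate\<close>)
qed

end

theorem theorem5p3:
  fixes \<mu> :: "nat \<Rightarrow> real" and r :: "nat \<Rightarrow> nat \<Rightarrow> complex" and \<alpha> \<beta> \<gamma> :: real
  assumes mu_pos: "\<And>n. n \<ge> 1 \<Longrightarrow> \<mu> n > 0"
    and mu_lim: "filterlim \<mu> at_top sequentially"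
    and params: "(\<alpha>, \<beta>, \<gamma>) \<in> E"
    and roots: "\<And>n. n \<ge> 1 \<Longrightarrow>
      image_mset (r n) (mset_set {1..4}) = proots (quartic (\<mu> n) \<alpha> \<beta> \<gamma>)"
  shows
    "((\<alpha>, \<beta>, \<gamma>) \<in> V1 \<longrightarrow> roots_asymp \<mu> r
        (sep_pair (-1/4) (2*\<alpha> + \<beta> - \<gamma>) (sqrt 2) (\<gamma>/2))
        (sep_pair (-1/2) \<beta> 1 (1/2))) \<and>
     ((\<alpha>, \<beta>, \<gamma>) \<in> V2 \<longrightarrow> roots_asymp \<mu> r
        (sep_pair (-1/2) \<beta> 1 \<alpha>)
        (sep_pair (-1) (-2*\<alpha> + \<beta> + \<gamma>) (sqrt 2) (-\<alpha> + \<gamma>/2 + 1/2))) \<and>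
     ((\<alpha>, \<beta>, \<gamma>) \<in> V3 \<longrightarrow> roots_asymp \<mu> r
        (sep_pair (-1/4) (2*\<alpha> + \<beta> - \<gamma>) (sqrt 2) (\<gamma>/2))
        (real_pair (-1) (1 - \<beta>) (-1) \<beta>)) \<and>
     ((\<alpha>, \<beta>, \<gamma>) \<in> V4 \<longrightarrow> roots_asymp \<mu> r
        (sep_pair (-1/2) \<beta> 1 \<alpha>)
        (real_pair (-1) (1 - \<beta>) (-2) (-2*\<alpha> + \<beta> + \<gamma>))) \<and>
     ((\<alpha>, \<beta>, \<gamma>) \<in> V5 \<longrightarrow> roots_asymp \<mu> r
        (real_pair (-1) (1 - \<beta>) (-1) \<beta>)
        (sep_pair (-1/2) (2*\<alpha> - \<beta>) (sqrt 2) (\<gamma>/2))) \<and>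
     ((\<alpha>, \<beta>, \<gamma>) \<in> V6 \<longrightarrow> roots_asymp \<mu> r
        (real_pair (-1) (2*\<alpha> - \<beta>) (-1) \<beta>)
        (real_pair (-2) (-2*\<alpha> + \<beta> + \<gamma>) (-1) (1 - \<beta>))) \<and>
     ((\<alpha>, \<beta>, \<gamma>) \<in> F12 \<longrightarrow> roots_asymp \<mu> r
        (sep_pair (-1/6) \<beta> (sqrt 3) (\<gamma>/2))
        (sep_pair (-1/3) \<beta> (sqrt 6 / 3) (1/2))) \<and>
     ((\<alpha>, \<beta>, \<gamma>) \<in> F13 \<longrightarrow> roots_asymp \<mu> r
        (sep_pair (-1/4) (2*\<alpha> + \<beta> - \<gamma>) (sqrt 2) (\<gamma>/2))
        (sep_pair (-1/2) \<beta> (sqrt 3 / 2) (1/2))) \<and>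
     ((\<alpha>, \<beta>, \<gamma>) \<in> F24 \<longrightarrow> roots_asymp \<mu> r
        (sep_pair (-1/2) \<beta> 1 \<alpha>)
        (cplx_pair (-1) 1 (1 - \<beta>))) \<and>
     ((\<alpha>, \<beta>, \<gamma>) \<in> F34 \<longrightarrow> roots_asymp \<mu> r
        (sep_pair (-1/6) \<beta> (sqrt 3) (\<gamma>/2))
        (real_pair (-1) (1 - \<beta>) (-2/3) \<beta>)) \<and>
     ((\<alpha>, \<beta>, \<gamma>) \<in> F35 \<longrightarrow> roots_asymp \<mu> r
        (real_pair (-1) (1 - \<beta>) (-1) \<beta>)
        (sep_pair (-1/6) (2*\<alpha> - \<beta>) (sqrt 2) (\<gamma>/2))) \<and>
     ((\<alpha>, \<beta>, \<gamma>) \<in> L1234 \<longrightarrow> roots_asymp \<mu> r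
        (sep_pair (-1/6) (1/2) (sqrt 3) (\<gamma>/2))
        (cplx_pair (-1/3) (sqrt 5 / 3) (1/2))) \<and>
     ((\<alpha>, \<beta>, \<gamma>) \<in> F1 \<longrightarrow> roots_asymp \<mu> r
        (sep_pair (-1) (2*\<alpha> + \<beta> - 1) (sqrt 2) (1/2))
        (sep_pair (-1/2) \<beta> 1 (1/2))) \<and>
     ((\<alpha>, \<beta>, \<gamma>) \<in> L12 \<longrightarrow> roots_asymp \<mu> r
        (sep_pair (-1/4) \<beta> (sqrt (2 + sqrt 2)) (1/2))
        (sep_pair (-1/4) \<beta> (sqrt (2 - sqrt 2)) (1/2))) \<and>
     ((\<alpha>, \<beta>, \<gamma>) \<in> L15 \<longrightarrow> roots_asymp \<mu> r
        (sep_pair (-1/3) (2*\<alpha> - 1/2) (sqrt 2) (1/2))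
        (sep_pair (-1/2) (1/2) (sqrt 3 / 2) (1/2))) \<and>
     ((\<alpha>, \<beta>, \<gamma>) \<in> L26 \<longrightarrow> roots_asymp \<mu> r
        (sep_pair (-1/2) \<beta> (sqrt 3 / 2) \<alpha>)
        (cplx_pair (-1) 1 (1 - \<beta>))) \<and>
     ((\<alpha>, \<beta>, \<gamma>) \<in> V1_bar \<longrightarrow> roots_asymp \<mu> r
        (sep_pair (-1/2) \<beta> 1 (1/2))
        (sep_pair (-1) (2*\<alpha> + \<beta> + \<gamma> - 2) (sqrt 2) (\<gamma>/2))) \<and>
     ((\<alpha>, \<beta>, \<gamma>) \<in> V2_bar \<longrightarrow> roots_asymp \<mu> r
        (sep_pair (-1/2) \<beta> 1 \<alpha>)
        (sep_pair (-1) (-2*\<alpha> + \<beta> + \<gamma>) (sqrt 2) (-\<alpha> + \<gamma>/2 + 1/2))) \<and>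
     ((\<alpha>, \<beta>, \<gamma>) \<in> V3_bar \<longrightarrow> roots_asymp \<mu> r
        (real_pair (-1) (1 - \<beta>) (-1) \<beta>)
        (sep_pair (-1) (2*\<alpha> + \<beta> + \<gamma> - 2) (sqrt 2) (\<gamma>/2))) \<and>
     ((\<alpha>, \<beta>, \<gamma>) \<in> V4_bar \<longrightarrow> roots_asymp \<mu> r
        (real_pair (-1) (2*\<alpha> - \<beta>) (-1) \<beta>)
        (sep_pair (-1) (-2*\<alpha> + \<beta> + \<gamma>) (sqrt 2) (-\<alpha> + \<gamma>/2 + 1/2))) \<and>
     ((\<alpha>, \<beta>, \<gamma>) \<in> V5_bar \<longrightarrow> roots_asymp \<mu> r
        (real_pair (-1) (1 - \<beta>) (-1) \<beta>)
        (sep_pair (-1/2) (2*\<alpha> - \<beta>) (sqrt 2) (\<gamma>/2))) \<and>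
     ((\<alpha>, \<beta>, \<gamma>) \<in> F12_bar \<longrightarrow> roots_asymp \<mu> r
        (sep_pair (-1/2) \<beta> (sqrt 2) (1/2))
        (sep_pair (-1/4) (\<beta> + \<gamma> - 1) 1 (\<gamma>/2))) \<and>
     ((\<alpha>, \<beta>, \<gamma>) \<in> F13_bar \<longrightarrow> roots_asymp \<mu> r
        (sep_pair (-1/2) (1/2) (sqrt 3 / 2) (1/2))
        (sep_pair (-1) (2*\<alpha> + \<gamma> - 3/2) (sqrt 2) (\<gamma>/2))) \<and>
     ((\<alpha>, \<beta>, \<gamma>) \<in> F24_bar \<longrightarrow> roots_asymp \<mu> r
        (sep_pair (-1/2) \<alpha> (sqrt 3 / 2) \<alpha>)
        (sep_pair (-1) (\<gamma> - \<alpha>) (sqrt 2) (-\<alpha> + \<gamma>/2 + 1/2))) \<and>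
     ((\<alpha>, \<beta>, \<gamma>) \<in> F34_bar \<longrightarrow> roots_asymp \<mu> r
        (real_pair (-2) (1 - \<beta>) (-1) \<beta>)
        (sep_pair (-1/4) (\<beta> + \<gamma> - 1) 1 (\<gamma>/2))) \<and>
     ((\<alpha>, \<beta>, \<gamma>) \<in> F35_bar \<longrightarrow> roots_asymp \<mu> r
        (real_pair (-1) (\<gamma>/2) (-1) (1 - \<gamma>/2))
        (sep_pair (-1/3) (2*\<alpha> + \<gamma>/2 - 1) (sqrt 2) (\<gamma>/2))) \<and>
     ((\<alpha>, \<beta>, \<gamma>) \<in> L1234_bar \<longrightarrow> roots_asymp \<mu> r
        (sep_pair (-1/2) (1/2) (sqrt 7 / 2) (1/2))
        (sep_pair (-1/4) (\<gamma> - 1/2) 1 (\<gamma>/2)))"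
proof -
  interpret quartic_roots \<mu> r \<alpha> \<beta> \<gamma>
    by unfold_locales (fact mu_lim roots)+
  show ?thesis
    by (intro conjI; intro impI;
      (rule roots_V1 roots_V2 roots_V3 roots_V4 roots_V5 roots_V6 roots_F12 roots_F13 roots_F24
       roots_F34 roots_F35 roots_L1234 roots_F1 roots_L12 roots_L15 roots_L26 roots_V1_bar
       roots_V2_bar roots_V3_bar roots_V4_bar roots_V5_bar roots_F12_bar roots_F13_bar
       roots_F24_bar roots_F34_bar roots_F35_bar roots_L1234_bar, assumption))
qed

end
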